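(* Assume (A1) and (A2) hold (see context). Let $n_\star=\min\{n,N-n\}$, let $\delta\in(0,1)$ and assume that the tuning parameter $\lambda$ satisfies $$\lambda\ \ge\ 4B_Y\Big(\frac{\log(2p/\delta)}{n_\star}\Big)^{1/2}\bigg[1+\frac{B_X}{3}\Big(\frac{\log(2p/\delta)}{n_\star}\Big)^{1/2}\bigg].$$ Let $\hat{\boldsymbol\beta}$ be the transductive lasso estimator, $$\hat{\boldsymbol\beta}\in\operatorname*{arg\,min}_{\boldsymbol\beta\in\mathbb R^p}\Big\{\|\hat{\mathbf\Sigma}_{\rm unlab}^{1/2}\boldsymbol\beta\|_2^2-\frac2n\boldsymbol Y^\top\mathbf X_{\rm lab}\boldsymbol\beta+2\lambda\|\boldsymbol\beta\|_1\Big\}.$$ Then, with probability at least $1-\delta$, $$\mathcal E_{\rm TL}(f_{\hat{\boldsymbol\beta}})\le\inf_{\boldsymbol\beta\in\mathbb R^p,\ J\subseteq[p]}\bigg\{\mathcal E_{\rm TL}(f_{\boldsymbol\beta})+4\lambda\|\boldsymbol\beta_{J^c}\|_1+\frac{9\lambda^2|J|}{4\,\kappa_{\hat{\mathbf\Sigma}_{\rm unlab}}(J,3)}\bigg\}.$$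
   Context: Setting. $p\ge1$ and $1\le n<N$ are integers, $[k]=\{1,\dots,k\}$. $(\boldsymbol X,Y)$ is a random pair in $\mathbb R^p\times\mathbb R$ with distribution $P$; $P_X$ is the marginal distribution of $\boldsymbol X=(X^1,\dots,X^p)^\top$; $f^\star(\boldsymbol x)=\mathbb E[Y\mid\boldsymbol X=\boldsymbol x]$. The labeled data $(\boldsymbol X_1,Y_1),\dots,(\boldsymbol X_n,Y_n)$ are i.i.d. with distribution $P$; the unlabeled data $\boldsymbol X_{n+1},\dots,\boldsymbol X_N$ are i.i.d. with distribution $P_X$ and independent of the labeled data. $\boldsymbol Y=(Y_1,\dots,Y_n)^\top$ and $\mathbf X_{\rm lab}\in\mathbb R^{n\times p}$ is the matrix with rows $\boldsymbol X_1^\top,\dots,\boldsymbol X_n^\top$. $\hat{\mathbf\Sigma}_{\rm unlab}=\frac1{N-n}\sum_{i=n+1}^N\boldsymbol X_i\boldsymbol X_i^\top$. Assumptions. (A1): $Y$ and $\boldsymbol X$ have zero mean and finite variance, and $\mathbb E[(X^j)^2]=1$ for all $j\in[p]$. (A2): there exist constants $B_Y,B_X$ such that $\mathbf P(|Y|\le B_Y;\ \max_{j\in[p]}|X^j|\le B_X)=1$. Linear predictors: $f_{\boldsymbol\beta}(\boldsymbol x)=\boldsymbol x^\top\boldsymbol\beta$ for $\boldsymbol\beta\in\mathbb R^p$. The transductive excess risk is $\mathcal E_{\rm TL}(f)=\frac1{N-n}\sum_{i=n+1}^N(f(\boldsymbol X_i)-f^\star(\boldsymbol X_i))^2$. The tuning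 parameter satisfies $\lambda>0$. For $J\subseteq[p]$ and $\boldsymbol v\in\mathbb R^p$, $\boldsymbol v_J\in\mathbb R^p$ has $j$-th coordinate $v_j$ if $j\in J$ and $0$ otherwise; $J^c=[p]\setminus J$. For a symmetric positive semidefinite $p\times p$ matrix $\mathbf A$ and $c>0$, the compatibility constant is $$\kappa_{\mathbf A}(J,c)=\inf\bigg\{\frac{c^2|J|\,\|\mathbf A^{1/2}\boldsymbol v\|_2^2}{(c\|\boldsymbol v_J\|_1-\|\boldsymbol v_{J^c}\|_1)^2}:\ \boldsymbol v\in\mathbb R^p,\ \|\boldsymbol v_{J^c}\|_1<c\|\boldsymbol v_J\|_1\bigg\}.$$ Conventions: the infimum over the empty set is $+\infty$; a ratio with denominator $+\infty$ is $0$, and a positive number divided by $0$ is $+\infty$. *)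

theory Defs
  imports "HOL-Probability.Probability"
begin

definition psd_matrix :: "real^'p^'p \<Rightarrow> bool" where
  "psd_matrix A \<longleftrightarrow> transpose A = A \<and> (\<forall>v. 0 \<le> v \<bullet> (A *v v))"

text \<open>The positive semidefinite square root; it is unique, and it exists whenever the argument is
  itself symmetric positive semidefinite. The value is unspecified otherwise.\<close>

definition matrix_sqrt :: "real^'p^'p \<Rightarrow> real^'p^'p" where
  "matrix_sqrt A = (THE B. psd_matrix B \<and> B ** B = A)"

definition l1_norm :: "real^'p \<Rightarrow> real" where
  "l1_norm v = (\<Sum>j\<in>UNIV. \<bar>v $ j\<bar>)"

definition restrict_vec :: "'p set \<Rightarrow> real^'p \<Rightarrow> real^'p" where
  "restrict_vec J v = (\<chi> j. if j \<in> J then v $ j else 0)"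

text \<open>Extended reals make the infimum over the empty set (for instance when \<open>J = {}\<close>) equal to
  \<open>\<infinity>\<close>. The real division is by a strictly positive number for every admissible \<open>v\<close>.\<close>

definition compatibility_constant :: "real^'p^'p \<Rightarrow> 'p set \<Rightarrow> real \<Rightarrow> ereal" where
  "compatibility_constant A J c =
     (INF v \<in> {v. l1_norm (restrict_vec (- J) v) < c * l1_norm (restrict_vec J v)}.
        ereal (c\<^sup>2 * real (card J) * (norm (matrix_sqrt A *v v))\<^sup>2
               / (c * l1_norm (restrict_vec J v) - l1_norm (restrict_vec (- J) v))\<^sup>2))"

definition linear_predictor :: "real^'p \<Rightarrow> real^'p \<Rightarrow> real" where
  "linear_predictor \<beta> x = x \<bullet> \<beta>"

text \<open>Below, \<open>x\<close> and \<open>y\<close> are realised features and labels. Observations are numbered from 1;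
  those with index in \<open>{1..n}\<close> are labeled and those in \<open>{n+1..N}\<close> are unlabeled.\<close>

definition Sigma_unlab :: "nat \<Rightarrow> nat \<Rightarrow> (nat \<Rightarrow> real^'p) \<Rightarrow> real^'p^'p" where
  "Sigma_unlab n N x = (1 / real (N - n)) *\<^sub>R (\<Sum>i=n+1..N. (\<chi> j k. x i $ j * x i $ k))"

definition transductive_risk ::
    "nat \<Rightarrow> nat \<Rightarrow> (real^'p \<Rightarrow> real) \<Rightarrow> (nat \<Rightarrow> real^'p) \<Rightarrow> (real^'p \<Rightarrow> real) \<Rightarrow> real" where
  "transductive_risk n N f_star x f = 1 / real (N - n) * (\<Sum>i=n+1..N. (f (x i) - f_star (x i))\<^sup>2)"

text \<open>The sum over \<open>i\<close> is the product of the transposed label vector, the labeled design matrix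
  (whose \<open>i\<close>-th row is \<open>x i\<close>) and \<open>\<beta>\<close>.\<close>

definition lasso_objective ::
    "nat \<Rightarrow> nat \<Rightarrow> real \<Rightarrow> (nat \<Rightarrow> real^'p) \<Rightarrow> (nat \<Rightarrow> real) \<Rightarrow> real^'p \<Rightarrow> real" where
  "lasso_objective n N lam x y \<beta> =
     (norm (matrix_sqrt (Sigma_unlab n N x) *v \<beta>))\<^sup>2
     - 2 / real n * (\<Sum>i=1..n. y i * (x i \<bullet> \<beta>)) + 2 * lam * l1_norm \<beta>"

definition is_transductive_lasso ::
    "nat \<Rightarrow> nat \<Rightarrow> real \<Rightarrow> (nat \<Rightarrow> real^'p) \<Rightarrow> (nat \<Rightarrow> real) \<Rightarrow> real^'p \<Rightarrow> bool" where
  "is_transductive_lasso n N lam x y \<beta> \<longleftrightarrow> is_arg_min (lasso_objective n N lam x y) (\<lambda>_. True) \<beta>"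

text \<open>The law \<open>P\<close> of the generic pair is a measure on the product space, so that the pair itself is
  \<open>(fst, snd)\<close> and the marginal law of the features is \<open>distr P borel fst\<close>.\<close>

definition centered_normalized :: "((real^'p) \<times> real) measure \<Rightarrow> bool" where
  "centered_normalized P \<longleftrightarrow>
     integrable P (\<lambda>z. (snd z)\<^sup>2) \<and> (\<integral>z. snd z \<partial>P) = 0 \<and>
     (\<forall>j. integrable P (\<lambda>z. (fst z $ j)\<^sup>2) \<and> (\<integral>z. fst z $ j \<partial>P) = 0 \<and>
          (\<integral>z. (fst z $ j)\<^sup>2 \<partial>P) = 1)"

definition bounded_by :: "((real^'p) \<times> real) measure \<Rightarrow> real \<Rightarrow> real \<Rightarrow> bool" where
  "bounded_by P B_Y B_X \<longleftrightarrow>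
     measure P {z \<in> space P. \<bar>snd z\<bar> \<le> B_Y \<and> (MAX j. \<bar>fst z $ j\<bar>) \<le> B_X} = 1"

text \<open>A Borel version of \<open>x \<mapsto> E(Y | X = x)\<close>: composed with the features it is a conditional
  expectation of the label given the sigma-algebra generated by the features.\<close>

definition is_regression_function ::
    "((real^'p) \<times> real) measure \<Rightarrow> (real^'p \<Rightarrow> real) \<Rightarrow> bool" where
  "is_regression_function P f \<longleftrightarrow>
     f \<in> borel_measurable borel \<and>
     (AE z in P. f (fst z) = real_cond_exp P (vimage_algebra (space P) fst borel) snd z)"

text \<open>The last clause states that the labeled and the unlabeled data are independent, through the
  sigma-algebras they generate, since \<open>indep_var\<close> relates only variables with values in the same type.
  Labels \<open>Y i\<close> with \<open>i > n\<close> are unconstrained and never used.\<close>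

definition semisupervised_sample ::
    "'a measure \<Rightarrow> ((real^'p) \<times> real) measure \<Rightarrow> nat \<Rightarrow> nat \<Rightarrow>
      (nat \<Rightarrow> 'a \<Rightarrow> real^'p) \<Rightarrow> (nat \<Rightarrow> 'a \<Rightarrow> real) \<Rightarrow> bool" where
  "semisupervised_sample M P n N X Y \<longleftrightarrow>
     (\<forall>i\<in>{1..N}. X i \<in> borel_measurable M) \<and>
     (\<forall>i\<in>{1..n}. Y i \<in> borel_measurable M) \<and>
     (\<forall>i\<in>{1..n}. distr M borel (\<lambda>\<omega>. (X i \<omega>, Y i \<omega>)) = P) \<and>
     (\<forall>i\<in>{n+1..N}. distr M borel (X i) = distr P borel fst) \<and>
     prob_space.indep_vars M (\<lambda>_. borel) (\<lambda>i \<omega>. (X i \<omega>, Y i \<omega>)) {1..n} \<and>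
     prob_space.indep_vars M (\<lambda>_. borel) X {n+1..N} \<and>
     prob_space.indep_set M
       (sets (vimage_algebra (space M) (\<lambda>\<omega>. \<lambda>i\<in>{1..n}. (X i \<omega>, Y i \<omega>)) (PiM {1..n} (\<lambda>_. borel))))
       (sets (vimage_algebra (space M) (\<lambda>\<omega>. \<lambda>i\<in>{n+1..N}. X i \<omega>) (PiM {n+1..N} (\<lambda>_. borel))))"

end

theory Submission
  imports Defs
begin

text \<open>Complete the square in the objective with the values \<open>f_star (X i)\<close> at the unlabeled points: up to
  a term free of \<open>\<beta>\<close>, the transductive lasso minimises
  \<open>E(\<beta>) - 2 (g \<bullet> \<beta>) + 2 lam |\<beta>|\<close>, where \<open>E\<close> is the transductive risk, \<open>|\<beta>|\<close> the 1-norm and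
  \<open>g = 1/n \<Sum> Y i X i - 1/(N - n) \<Sum> f_star (X i) X i\<close> compares the labeled and the unlabeled estimate
  of the same moment vector \<open>E (Y X)\<close>. All the noise is in \<open>g\<close>.

  If every coordinate of \<open>g\<close> is at most \<open>lam / 2\<close> in absolute value, the penalty dominates the linear
  term. The objective is then coercive, so that a minimiser exists
  (\<open>transductive_lasso_exists\<close>), and comparing the minimiser \<open>b\<close> with points on the segment towards
  \<open>\<beta>\<close> yields \<open>E(b) + Q(\<beta> - b) \<le> E(\<beta>) + 4 lam |\<beta> off J| + lam T\<close>, where \<open>Q\<close> is the quadratic form of
  the Gram matrix of the unlabeled points and \<open>T = 3 |(\<beta> - b) on J| - |(\<beta> - b) off J|\<close>. The compatibility constant
  bounds \<open>Q\<close> below by a multiple of \<open>T\<^sup>2\<close>, and completing the square in \<open>T\<close> leaves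
  \<open>9 lam\<^sup>2 |J| / (4 \<kappa>)\<close> (\<open>transductive_lasso_oracle_inequality\<close>). Since the objective and the
  compatibility constant are stated with a square root of the Gram matrix, this part relies on existence
  and uniqueness of positive semidefinite square roots (\<open>norm_matrix_sqrt_mult\<close>).

  The probability that \<open>g\<close> is small comes from a Bernstein bound. Conditional expectation gives \<open>Y X j\<close> and
  \<open>f_star X * X j\<close> the same mean; both are bounded by \<open>B_Y B_X\<close> and have second moment at most \<open>B_Y\<^sup>2\<close>,
  because \<open>X j\<close> has second moment 1. So each coordinate of \<open>g\<close> is a sum of \<open>N\<close> independent centred
  variables, with total variance at most \<open>2 B_Y\<^sup>2 / k\<close> and each bounded by \<open>2 B_Y B_X / k\<close>, where
  \<open>k = min n (N - n)\<close>. Treating both samples as one sum, rather than bounding two deviations,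
  makes the exponent match the prescribed \<open>lam\<close>: with \<open>L = ln (2 p / \<delta>)\<close> each of the \<open>2 p\<close> one-sided events fails
  with probability at most \<open>exp (- L)\<close>, and the union bound gives \<open>\<delta>\<close>
  (\<open>moment_gap_concentration\<close>).\<close>

section \<open>Square roots of positive semidefinite matrices\<close>

text \<open>A maximiser \<open>e\<close> of the Rayleigh quotient over the unit sphere of \<open>S\<close>, with maximum \<open>m\<close>, is an
  eigenvector: the form \<open>m (x \<bullet> x) - x \<bullet> T x\<close> is nonnegative on \<open>S\<close> and vanishes at \<open>e\<close>, so its
  derivative at \<open>e\<close> in the direction of the residual \<open>m e - T e\<close> must vanish, and this derivative is twice the
  squared norm of the residual.\<close>

lemma self_adjoint_eigenvector_of_max:
  fixes T :: "'a::euclidean_space \<Rightarrow> 'a"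
  assumes lin: "linear T" and sa: "\<And>x y. x \<bullet> T y = T x \<bullet> y"
    and S: "subspace S" and inv: "\<And>x. x \<in> S \<Longrightarrow> T x \<in> S" and nontriv: "S \<noteq> {0}"
  obtains e where "e \<in> S" "norm e = 1" "T e = (e \<bullet> T e) *\<^sub>R e"
    "\<And>x. x \<in> S \<Longrightarrow> x \<bullet> T x \<le> (e \<bullet> T e) * (x \<bullet> x)"
proof -
  have "closed S" using S by (rule closed_subspace)
  then have cpt: "compact (S \<inter> sphere 0 1)" by (simp add: closed_Int_compact)
  obtain x0 where "x0 \<in> S" "x0 \<noteq> 0" using nontriv S subspace_0 by fastforce
  then have "(1 / norm x0) *\<^sub>R x0 \<in> S \<inter> sphere 0 1"
    using S by (simp add: subspace_scale)
  then have ne: "S \<inter> sphere 0 1 \<noteq> {}" by blast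
  have "continuous_on (S \<inter> sphere 0 1) (\<lambda>x. x \<bullet> T x)"
    using lin by (intro continuous_intros linear_continuous_on linear_linear[THEN iffD1]) (simp add: linear_conv_bounded_linear)+
  from continuous_attains_sup[OF cpt ne this] obtain e where e: "e \<in> S" "norm e = 1"
    and emax: "\<And>x. x \<in> S \<Longrightarrow> norm x = 1 \<Longrightarrow> x \<bullet> T x \<le> e \<bullet> T e"
    by auto
  define m where "m = e \<bullet> T e"
  have max: "x \<bullet> T x \<le> m * (x \<bullet> x)" if "x \<in> S" for x
  proof (cases "x = 0")
    case True then show ?thesis by simp
  next
    case False
    define u where "u = (1 / norm x) *\<^sub>R x"
    have "u \<in> S" "norm u = 1" using that False S by (auto simp: u_def subspace_scale)
    then have "u \<bullet> T u \<le> m" unfolding m_def by (rule emax)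
    moreover have "u \<bullet> T u = (x \<bullet> T x) / (x \<bullet> x)"
      using lin by (simp add: u_def linear_scale dot_square_norm power2_eq_square)
    ultimately show ?thesis using False by (simp add: divide_le_eq mult.commute)
  qed
  define r where "r = m *\<^sub>R e - T e"
  have rS: "r \<in> S" using e inv S by (simp add: r_def subspace_diff subspace_scale)
  define q where "q = m * (r \<bullet> r) - r \<bullet> T r"
  have q0: "0 \<le> q" using max[OF rS] by (simp add: q_def)
  have ee: "e \<bullet> e = 1" using e by (simp add: dot_square_norm)
  have perturb: "0 \<le> 2 * s * (r \<bullet> r) + s\<^sup>2 * q" for s
  proof -
    have "e + s *\<^sub>R r \<in> S" using e rS S by (simp add: subspace_add subspace_scale)
    from max[OF this] have "0 \<le> m * ((e + s *\<^sub>R r) \<bullet> (e + s *\<^sub>R r)) - (e + s *\<^sub>R r) \<bullet> T (e + s *\<^sub>R r)" by simp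
    also have "\<dots> = 2 * s * (m * (e \<bullet> r) - T e \<bullet> r) + s\<^sup>2 * q"
      using lin sa[of e r] ee
      by (simp add: linear_add linear_scale q_def inner_add inner_commute[of r e] inner_commute[of r "T e"]
          m_def[symmetric] algebra_simps power2_eq_square)
    also have "m * (e \<bullet> r) - T e \<bullet> r = r \<bullet> r" by (simp add: r_def inner_diff inner_commute[of "T e" e])
    finally show ?thesis .
  qed
  have "r \<bullet> r = 0"
  proof (rule ccontr)
    assume "r \<bullet> r \<noteq> 0"
    then have pos: "r \<bullet> r > 0" by simp
    \<comment> \<open>A negative step short enough for the linear term in \<open>perturb\<close> to win over the quadratic one.\<close>
    define s where "s = - (r \<bullet> r) / (q + 1)"
    have sq: "s * q = - (r \<bullet> r) - s" using q0 by (simp add: s_def field_simps)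
    have "s < 0" using pos q0 by (simp add: s_def divide_neg_pos)
    have "2 * s * (r \<bullet> r) + s\<^sup>2 * q = s * (2 * (r \<bullet> r) + s * q)"
      by (simp add: power2_eq_square algebra_simps)
    also have "\<dots> = s * (r \<bullet> r - s)" by (simp add: sq)
    also have "\<dots> < 0" using pos \<open>s < 0\<close> by (intro mult_neg_pos) linarith+
    finally show False using perturb[of s] by simp
  qed
  then have "T e = m *\<^sub>R e" by (simp add: r_def)
  then show ?thesis using max unfolding m_def by (rule that[OF e])
qed

text \<open>An orthonormal system of eigenvectors of maximal size spans: its orthogonal complement is
  invariant, so a nontrivial complement would contain a further eigenvector.\<close>

lemma self_adjoint_orthonormal_eigenbasis:
  fixes T :: "'a::euclidean_space \<Rightarrow> 'a"
  assumes lin: "linear T" and sa: "\<And>x y. x \<bullet> T y = T x \<bullet> y"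
  obtains E where "finite E" "pairwise orthogonal E" "\<And>e. e \<in> E \<Longrightarrow> norm e = 1"
    "\<And>e. e \<in> E \<Longrightarrow> T e = (e \<bullet> T e) *\<^sub>R e" "span E = UNIV"
proof -
  define good where "good E \<longleftrightarrow> pairwise orthogonal E \<and> (\<forall>e\<in>E. norm e = 1 \<and> T e = (e \<bullet> T e) *\<^sub>R e)" for E
  have fin: "finite E \<and> card E \<le> DIM('a)" if "good E" for E
  proof -
    have "independent E" using that by (intro pairwise_orthogonal_independent) (auto simp: good_def)
    then show ?thesis by (rule independent_bound)
  qed
  have "good {}" by (simp add: good_def)
  then obtain E where E: "good E" and Emax: "\<And>F. good F \<Longrightarrow> card F \<le> card E"
    using fin ex_has_greatest_nat[of good "{}" card "DIM('a) + 1"] by (metis add.commute le_imp_less_Suc plus_1_eq_Suc)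
  have "span E = UNIV"
  proof (rule ccontr)
    assume ns: "span E \<noteq> UNIV"
    define S where "S = {x. \<forall>e\<in>E. e \<bullet> x = 0}"
    have sub: "subspace S" by (auto simp: S_def subspace_def inner_add_right)
    have inv: "T x \<in> S" if "x \<in> S" for x
    proof -
      have "e \<bullet> T x = 0" if "e \<in> E" for e
      proof -
        have "e \<bullet> T x = ((e \<bullet> T e) *\<^sub>R e) \<bullet> x" using E \<open>e \<in> E\<close> sa[of e x] by (simp add: good_def)
        then show ?thesis using \<open>x \<in> S\<close> \<open>e \<in> E\<close> by (simp add: S_def)
      qed
      then show ?thesis by (simp add: S_def)
    qed
    obtain a where a: "a \<noteq> 0" "\<And>x. x \<in> span E \<Longrightarrow> orthogonal a x"
      using orthogonal_to_subspace_exists_gen[of E UNIV] ns by auto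
    then have "a \<in> S" by (auto simp: S_def span_base orthogonal_def inner_commute)
    with a have "S \<noteq> {0}" by auto
    from self_adjoint_eigenvector_of_max[OF lin sa sub inv this]
    obtain e where e: "e \<in> S" "norm e = 1" "T e = (e \<bullet> T e) *\<^sub>R e" by metis
    then have new: "e \<notin> E" by (auto simp: S_def dot_square_norm)
    have "good (insert e E)"
      using E e by (auto simp: good_def pairwise_insert S_def orthogonal_def inner_commute)
    from Emax[OF this] fin[OF E] new show False by simp
  qed
  then show ?thesis using E fin[OF E] by (intro that[of E]) (auto simp only: good_def)
qed

lemma psd_matrix_self_adjoint:
  fixes A :: "real^'p^'p"
  assumes "psd_matrix A" shows "x \<bullet> (A *v y) = (A *v x) \<bullet> y"
proof -
  have "x \<bullet> (A *v y) = (x v* A) \<bullet> y" by (rule dot_lmul_matrix[symmetric])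
  also have "x v* A = transpose A *v x" by (rule transpose_matrix_vector[symmetric])
  also have "transpose A = A" using assms by (simp add: psd_matrix_def)
  finally show ?thesis .
qed

text \<open>Take square roots of the eigenvalues in an orthonormal eigenbasis.\<close>

lemma psd_matrix_has_square_root:
  fixes A :: "real^'p^'p"
  assumes "psd_matrix A" shows "\<exists>B. psd_matrix B \<and> B ** B = A"
proof -
  obtain E where fin: "finite E" and orth: "pairwise orthogonal E" and one: "\<And>e. e \<in> E \<Longrightarrow> norm e = 1"
    and eig: "\<And>e. e \<in> E \<Longrightarrow> A *v e = (e \<bullet> (A *v e)) *\<^sub>R e" and sp: "span E = UNIV"
    using self_adjoint_orthonormal_eigenbasis[of "(*v) A"] psd_matrix_self_adjoint[OF assms]
    by (metis matrix_vector_mul_linear)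
  define mu where "mu e = e \<bullet> (A *v e)" for e
  have mu0: "0 \<le> mu e" for e using assms by (simp add: mu_def psd_matrix_def)
  define b where "b x = (\<Sum>e\<in>E. (sqrt (mu e) * (e \<bullet> x)) *\<^sub>R e)" for x
  have linb: "linear b"
    by (intro linearI) (simp_all add: b_def inner_add_right algebra_simps sum.distrib scaleR_sum_right)
  have be: "b e = sqrt (mu e) *\<^sub>R e" if "e \<in> E" for e
  proof -
    have "b e = (\<Sum>f\<in>E. if f = e then sqrt (mu e) *\<^sub>R e else 0)" unfolding b_def
    proof (rule sum.cong[OF refl])
      fix f assume "f \<in> E"
      then show "(sqrt (mu f) * (f \<bullet> e)) *\<^sub>R f = (if f = e then sqrt (mu e) *\<^sub>R e else 0)"
        using orth one[of e] that by (auto simp: pairwise_def orthogonal_def dot_square_norm)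
    qed
    then show ?thesis using fin that by simp
  qed
  have "b (b x) = A *v x" for x
  proof (rule linear_eq_on[where B = E and f = "\<lambda>x. b (b x)" and g = "(*v) A"])
    show "linear (\<lambda>x. b (b x))" using linear_compose[OF linb linb] by (simp add: o_def)
    show "b (b e) = A *v e" if "e \<in> E" for e
      using that linb mu0[of e] eig[OF that] by (simp add: be linear_scale mu_def[symmetric])
  qed (simp_all add: sp)
  moreover have mb: "matrix b *v x = b x" for x
    using linb by (simp add: matrix_works)
  ultimately have "matrix b ** matrix b = A"
    by (simp add: matrix_eq matrix_vector_mul_assoc[symmetric])
  moreover have "psd_matrix (matrix b)"
  proof -
    have "x \<bullet> b y = b x \<bullet> y" for x y
      by (simp add: b_def inner_sum_left inner_sum_right algebra_simps inner_commute)
    then have "x \<bullet> (transpose (matrix b) *v y) = x \<bullet> (matrix b *v y)" for x y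
      by (metis mb dot_lmul_matrix inner_commute transpose_matrix_vector)
    then have "transpose (matrix b) = matrix b"
      by (metis matrix_eq vector_eq_rdot inner_commute)
    moreover have "0 \<le> x \<bullet> b x" for x
      by (auto simp: b_def inner_sum_right inner_commute[of x] mult.assoc mu0
          intro!: sum_nonneg mult_nonneg_nonneg[OF _ zero_le_square])
    ultimately show ?thesis by (simp add: psd_matrix_def mb)
  qed
  ultimately show ?thesis by blast
qed

text \<open>The eigenvalue \<open>m\<close> of \<open>D = B - C\<close> at the maximiser \<open>e\<close> of its Rayleigh quotient is zero. Indeed
  \<open>B\<^sup>2 - C\<^sup>2 = B D + D C\<close>, whence \<open>m (e \<bullet> B e + e \<bullet> C e) = 0\<close>; if \<open>m \<noteq> 0\<close> then both nonnegative
  summands vanish, and so does their difference \<open>m\<close>. Equal squares thus order the two forms, in both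
  directions by symmetry, which makes the square root unique.\<close>

lemma psd_square_root_le:
  fixes B C :: "real^'p^'p"
  assumes B: "psd_matrix B" and C: "psd_matrix C" and eq: "B ** B = C ** C"
  shows "x \<bullet> (B *v x) \<le> x \<bullet> (C *v x)"
proof -
  define D where "D y = B *v y - C *v y" for y
  have lin: "linear D" unfolding D_def by (intro linear_compose_sub) simp_all
  have sa: "y \<bullet> D z = D y \<bullet> z" for y z
    by (simp add: D_def inner_diff psd_matrix_self_adjoint[OF B] psd_matrix_self_adjoint[OF C])
  have "(UNIV :: (real^'p) set) \<noteq> {0}"
    by (metis UNIV_I axis_eq_0_iff singletonD zero_neq_one)
  with self_adjoint_eigenvector_of_max[OF lin sa, of UNIV] 
  obtain e where one: "norm e = 1" and eig: "D e = (e \<bullet> D e) *\<^sub>R e"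
    and max: "\<And>y. y \<bullet> D y \<le> (e \<bullet> D e) * (y \<bullet> y)" by (metis UNIV_I subspace_UNIV)
  define m where "m = e \<bullet> D e"
  have "m = 0"
  proof (rule ccontr)
    assume "m \<noteq> 0"
    have "B *v (B *v e) = C *v (C *v e)" by (simp add: matrix_vector_mul_assoc eq)
    then have "0 = e \<bullet> (B *v D e) + e \<bullet> D (C *v e)"
      by (simp add: D_def matrix_vector_mult_diff_distrib inner_diff)
    also have "\<dots> = m * (e \<bullet> (B *v e) + e \<bullet> (C *v e))"
      using sa[of e "C *v e"] eig by (simp add: m_def[symmetric] matrix_vector_mult_scaleR algebra_simps)
    finally have "e \<bullet> (B *v e) + e \<bullet> (C *v e) = 0" using \<open>m \<noteq> 0\<close> by simp
    moreover have "e \<bullet> (B *v e) \<ge> 0" "e \<bullet> (C *v e) \<ge> 0" using B C by (auto simp: psd_matrix_def)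
    ultimately show False using \<open>m \<noteq> 0\<close> by (simp add: m_def D_def inner_diff)
  qed
  with max[of x] show ?thesis by (simp add: m_def D_def inner_diff)
qed

lemma psd_square_root_unique:
  fixes B C :: "real^'p^'p"
  assumes B: "psd_matrix B" and C: "psd_matrix C" and eq: "B ** B = C ** C"
  shows "B = C"
proof -
  have quad: "x \<bullet> (B *v x) = x \<bullet> (C *v x)" for x
    using psd_square_root_le[OF B C eq] psd_square_root_le[OF C B eq[symmetric]] by (rule antisym)
  have "x \<bullet> (B *v y) = x \<bullet> (C *v y)" for x y
  proof -
    have "y \<bullet> (B *v x) = x \<bullet> (B *v y)" "y \<bullet> (C *v x) = x \<bullet> (C *v y)"
      using psd_matrix_self_adjoint[OF B, of x y] psd_matrix_self_adjoint[OF C, of x y]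
      by (simp_all add: inner_commute)
    then show ?thesis
      using quad[of "x + y"] quad[of x] quad[of y]
      by (simp add: matrix_vector_right_distrib inner_add)
  qed
  then have "B *v y = C *v y" for y by (metis vector_eq_rdot inner_commute)
  then show ?thesis by (simp add: matrix_eq)
qed

text \<open>With this identity the square root is eliminated: only the quadratic form of \<open>A\<close> remains.\<close>

lemma norm_matrix_sqrt_mult:
  fixes A :: "real^'p^'p"
  assumes "psd_matrix A" shows "(norm (matrix_sqrt A *v v))\<^sup>2 = v \<bullet> (A *v v)"
proof -
  have "\<exists>!B. psd_matrix B \<and> B ** B = A"
    using psd_matrix_has_square_root[OF assms] psd_square_root_unique by metis
  then have R: "psd_matrix (matrix_sqrt A) \<and> matrix_sqrt A ** matrix_sqrt A = A"
    unfolding matrix_sqrt_def by (rule theI')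
  have "(norm (matrix_sqrt A *v v))\<^sup>2 = v \<bullet> (matrix_sqrt A *v (matrix_sqrt A *v v))"
    by (simp add: power2_norm_eq_inner psd_matrix_self_adjoint[OF R[THEN conjunct1]])
  then show ?thesis by (simp add: matrix_vector_mul_assoc R)
qed

section \<open>Bernstein bounds through the moment generating function\<close>

text \<open>The Taylor tail of \<open>exp\<close> beyond the linear term is dominated by a geometric series of ratio \<open>b / 3\<close>,
  because \<open>(k + 2)! \<ge> 2 * 3 ^ k\<close>. This is the source of the factor 3 in Bernstein's inequality.\<close>

lemma exp_le_quadratic_bound:
  fixes x b :: real
  assumes xb: "\<bar>x\<bar> \<le> b" and b3: "b < 3"
  shows "exp x \<le> 1 + x + x\<^sup>2 / (2 * (1 - b / 3))"
proof -
  have fact_ge: "2 * 3 ^ k \<le> (fact (k + 2) :: real)" for k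
  proof (induction k)
    case (Suc k)
    have "2 * 3 ^ Suc k = 3 * (2 * 3 ^ k :: real)" by simp
    also have "\<dots> \<le> real (k + 3) * fact (k + 2)"
      using Suc by (intro mult_mono) auto
    also have "\<dots> = fact (Suc k + 2)" by (simp add: algebra_simps)
    finally show ?case .
  qed simp
  have b0: "0 \<le> b" using xb by linarith
  have sx: "(\<lambda>k. x ^ k / fact k) sums exp x"
    using exp_converges[of x] by (simp add: divide_inverse mult.commute)
  have "(\<lambda>k. x ^ (k + 2) / fact (k + 2)) sums (exp x - (\<Sum>k<2. x ^ k / fact k))"
    using sums_split_initial_segment[OF sx] .
  then have tail: "(\<lambda>k. x ^ (k + 2) / fact (k + 2)) sums (exp x - 1 - x)"
    by (simp add: numeral_2_eq_2 algebra_simps)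
  have "(\<lambda>k. (b / 3) ^ k) sums (1 / (1 - b / 3))"
    using b0 b3 by (intro geometric_sums) simp
  then have geo: "(\<lambda>k. x\<^sup>2 / 2 * (b / 3) ^ k) sums (x\<^sup>2 / 2 * (1 / (1 - b / 3)))"
    by (rule sums_mult)
  have "x ^ (k + 2) / fact (k + 2) \<le> x\<^sup>2 / 2 * (b / 3) ^ k" for k
  proof -
    have "x ^ (k + 2) / fact (k + 2) \<le> \<bar>x\<bar> ^ (k + 2) / fact (k + 2)"
      by (intro divide_right_mono) (simp_all only: abs_ge_self power_abs[symmetric] fact_ge_zero)
    also have "\<dots> \<le> \<bar>x\<bar> ^ (k + 2) / (2 * 3 ^ k)"
      using fact_ge[of k] by (intro divide_left_mono) auto
    also have "\<dots> = x\<^sup>2 / 2 * (\<bar>x\<bar> / 3) ^ k" by (simp add: power_add power_divide power2_eq_square)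
    also have "\<dots> \<le> x\<^sup>2 / 2 * (b / 3) ^ k"
      using xb by (intro mult_left_mono power_mono) auto
    finally show ?thesis .
  qed
  from sums_le[OF this tail geo] show ?thesis by simp
qed

text \<open>The right tail is sub-gamma with variance factor \<open>v\<close> and scale \<open>c\<close>. Working with this bound on the
  moment generating function, rather than with the tail, makes it additive over independent summands.\<close>

definition sub_gamma :: "'a measure \<Rightarrow> ('a \<Rightarrow> real) \<Rightarrow> real \<Rightarrow> real \<Rightarrow> bool" where
  "sub_gamma M Z v c \<longleftrightarrow> (\<forall>t. 0 \<le> t \<longrightarrow> c * t < 1 \<longrightarrow>
     integrable M (\<lambda>\<omega>. exp (t * Z \<omega>)) \<and>
     (\<integral>\<omega>. exp (t * Z \<omega>) \<partial>M) \<le> exp (v * t\<^sup>2 / (2 * (1 - c * t))))"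

lemma sub_gamma_mono:
  assumes Z: "sub_gamma M Z v c" and "v \<le> v'" "0 \<le> v'" "c \<le> c'"
  shows "sub_gamma M Z v' c'"
  unfolding sub_gamma_def
proof (intro allI impI)
  fix t :: real assume t: "0 \<le> t" "c' * t < 1"
  have ct: "c * t \<le> c' * t" using assms t by (simp add: mult_right_mono)
  have "v * t\<^sup>2 / (2 * (1 - c * t)) \<le> v' * t\<^sup>2 / (2 * (1 - c' * t))"
    using assms t ct by (intro frac_le mult_right_mono mult_nonneg_nonneg) auto
  then have "exp (v * t\<^sup>2 / (2 * (1 - c * t))) \<le> exp (v' * t\<^sup>2 / (2 * (1 - c' * t)))" by simp
  moreover have "integrable M (\<lambda>\<omega>. exp (t * Z \<omega>)) \<and>
     (\<integral>\<omega>. exp (t * Z \<omega>) \<partial>M) \<le> exp (v * t\<^sup>2 / (2 * (1 - c * t)))"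
    using Z t ct by (simp add: sub_gamma_def)
  ultimately show "integrable M (\<lambda>\<omega>. exp (t * Z \<omega>)) \<and>
     (\<integral>\<omega>. exp (t * Z \<omega>) \<partial>M) \<le> exp (v' * t\<^sup>2 / (2 * (1 - c' * t)))" by linarith
qed

lemma sub_gamma_distr:
  assumes [measurable]: "f \<in> measurable M N" "Z \<in> borel_measurable N"
  shows "sub_gamma (distr M N f) Z v c \<longleftrightarrow> sub_gamma M (\<lambda>\<omega>. Z (f \<omega>)) v c"
  by (simp add: sub_gamma_def integrable_distr_eq integral_distr)

lemma (in prob_space) sub_gamma_bounded:
  assumes [measurable]: "Z \<in> borel_measurable M"
    and bnd: "AE \<omega> in M. \<bar>Z \<omega>\<bar> \<le> b" and mean: "(\<integral>\<omega>. Z \<omega> \<partial>M) = 0"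
    and var: "(\<integral>\<omega>. (Z \<omega>)\<^sup>2 \<partial>M) \<le> v"
  shows "sub_gamma M Z v (b / 3)"
  unfolding sub_gamma_def
proof (intro allI impI)
  fix t :: real assume t: "0 \<le> t" "b / 3 * t < 1"
  have intZ: "integrable M Z" using bnd by (intro integrable_const_bound[of Z b]) auto
  have intZ2: "integrable M (\<lambda>\<omega>. (Z \<omega>)\<^sup>2)"
  proof (rule integrable_const_bound)
    show "AE \<omega> in M. norm ((Z \<omega>)\<^sup>2) \<le> b\<^sup>2"
      using bnd by eventually_elim (simp add: abs_le_square_iff[symmetric])
  qed simp
  have intE: "integrable M (\<lambda>\<omega>. exp (t * Z \<omega>))"
  proof (rule integrable_const_bound)
    show "AE \<omega> in M. norm (exp (t * Z \<omega>)) \<le> exp (t * b)"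
      using bnd by eventually_elim (use t in \<open>simp add: mult_left_mono\<close>)
  qed simp
  define k where "k = t\<^sup>2 / (2 * (1 - b / 3 * t))"
  have k0: "0 \<le> k" using t by (simp add: k_def)
  have "(\<integral>\<omega>. exp (t * Z \<omega>) \<partial>M) \<le> (\<integral>\<omega>. 1 + t * Z \<omega> + k * (Z \<omega>)\<^sup>2 \<partial>M)"
  proof (rule integral_mono_AE)
    show "AE \<omega> in M. exp (t * Z \<omega>) \<le> 1 + t * Z \<omega> + k * (Z \<omega>)\<^sup>2"
      using bnd
    proof eventually_elim
      fix \<omega> assume "\<bar>Z \<omega>\<bar> \<le> b"
      then have "\<bar>t * Z \<omega>\<bar> \<le> t * b" using t by (simp add: abs_mult mult_left_mono)
      from exp_le_quadratic_bound[OF this] t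
      show "exp (t * Z \<omega>) \<le> 1 + t * Z \<omega> + k * (Z \<omega>)\<^sup>2"
        by (simp add: k_def power_mult_distrib algebra_simps)
    qed
  qed (use intZ intZ2 intE in auto)
  also have "\<dots> = 1 + k * (\<integral>\<omega>. (Z \<omega>)\<^sup>2 \<partial>M)"
    using intZ intZ2 mean by (simp add: prob_space)
  also have "\<dots> \<le> 1 + k * v" using var k0 by (simp add: mult_left_mono)
  also have "\<dots> \<le> exp (k * v)" by (rule exp_ge_add_one_self)
  finally show "integrable M (\<lambda>\<omega>. exp (t * Z \<omega>)) \<and>
     (\<integral>\<omega>. exp (t * Z \<omega>) \<partial>M) \<le> exp (v * t\<^sup>2 / (2 * (1 - b / 3 * t)))"
    using intE by (simp add: k_def mult.commute)
qed

lemma (in prob_space) sub_gamma_sum: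
  assumes fin: "finite I" and indep: "indep_vars (\<lambda>_. borel) Z I"
    and Z: "\<And>i. i \<in> I \<Longrightarrow> sub_gamma M (Z i) (v i) c"
  shows "sub_gamma M (\<lambda>\<omega>. \<Sum>i\<in>I. Z i \<omega>) (\<Sum>i\<in>I. v i) c"
  unfolding sub_gamma_def
proof (intro allI impI)
  fix t :: real assume t: "0 \<le> t" "c * t < 1"
  have ind: "indep_vars (\<lambda>_. borel) (\<lambda>i \<omega>. exp (t * Z i \<omega>)) I"
    by (rule indep_vars_compose2[OF indep]) simp
  have int: "integrable M (\<lambda>\<omega>. exp (t * Z i \<omega>))" if "i \<in> I" for i
    using Z[OF that] t by (simp add: sub_gamma_def)
  have prod: "exp (t * (\<Sum>i\<in>I. Z i \<omega>)) = (\<Prod>i\<in>I. exp (t * Z i \<omega>))" for \<omega>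
    using fin by (simp add: sum_distrib_left exp_sum)
  have "(\<integral>\<omega>. exp (t * (\<Sum>i\<in>I. Z i \<omega>)) \<partial>M) = (\<Prod>i\<in>I. \<integral>\<omega>. exp (t * Z i \<omega>) \<partial>M)"
    unfolding prod by (rule indep_vars_lebesgue_integral[OF fin ind int])
  also have "\<dots> \<le> (\<Prod>i\<in>I. exp (v i * t\<^sup>2 / (2 * (1 - c * t))))"
    using Z t by (intro prod_mono) (simp add: sub_gamma_def)
  also have "\<dots> = exp ((\<Sum>i\<in>I. v i) * t\<^sup>2 / (2 * (1 - c * t)))"
    using fin by (simp add: exp_sum sum_distrib_right sum_divide_distrib)
  finally show "integrable M (\<lambda>\<omega>. exp (t * (\<Sum>i\<in>I. Z i \<omega>))) \<and>
     (\<integral>\<omega>. exp (t * (\<Sum>i\<in>I. Z i \<omega>)) \<partial>M) \<le> exp ((\<Sum>i\<in>I. v i) * t\<^sup>2 / (2 * (1 - c * t)))"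
    unfolding prod using indep_vars_integrable[OF fin ind int] by simp
qed

lemma (in prob_space) sub_gamma_add:
  assumes indep: "indep_var borel Z1 borel Z2"
    and Z: "sub_gamma M Z1 v1 c" "sub_gamma M Z2 v2 c"
  shows "sub_gamma M (\<lambda>\<omega>. Z1 \<omega> + Z2 \<omega>) (v1 + v2) c"
  unfolding sub_gamma_def
proof (intro allI impI)
  fix t :: real assume t: "0 \<le> t" "c * t < 1"
  have ind: "indep_var borel (\<lambda>\<omega>. exp (t * Z1 \<omega>)) borel (\<lambda>\<omega>. exp (t * Z2 \<omega>))"
    using indep_var_compose[OF indep, of "\<lambda>x. exp (t * x)" borel "\<lambda>x. exp (t * x)" borel] by (simp add: o_def)
  have int: "integrable M (\<lambda>\<omega>. exp (t * Z1 \<omega>))" "integrable M (\<lambda>\<omega>. exp (t * Z2 \<omega>))"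
    using Z t by (simp_all add: sub_gamma_def)
  have prod: "exp (t * (Z1 \<omega> + Z2 \<omega>)) = exp (t * Z1 \<omega>) * exp (t * Z2 \<omega>)" for \<omega>
    by (simp add: distrib_left exp_add)
  have "(\<integral>\<omega>. exp (t * (Z1 \<omega> + Z2 \<omega>)) \<partial>M) = (\<integral>\<omega>. exp (t * Z1 \<omega>) \<partial>M) * (\<integral>\<omega>. exp (t * Z2 \<omega>) \<partial>M)"
    unfolding prod by (rule indep_var_lebesgue_integral[OF ind int])
  also have "\<dots> \<le> exp (v1 * t\<^sup>2 / (2 * (1 - c * t))) * exp (v2 * t\<^sup>2 / (2 * (1 - c * t)))"
    using Z t by (intro mult_mono) (simp_all add: sub_gamma_def)
  also have "\<dots> = exp ((v1 + v2) * t\<^sup>2 / (2 * (1 - c * t)))"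
    by (simp add: exp_add[symmetric] add_divide_distrib distrib_right)
  finally show "integrable M (\<lambda>\<omega>. exp (t * (Z1 \<omega> + Z2 \<omega>))) \<and>
     (\<integral>\<omega>. exp (t * (Z1 \<omega> + Z2 \<omega>)) \<partial>M) \<le> exp ((v1 + v2) * t\<^sup>2 / (2 * (1 - c * t)))"
    unfolding prod using indep_var_integrable[OF ind int] by simp
qed

text \<open>Chernoff's method. The two terms of the threshold reflect the Gaussian and the exponential regime, and the chosen
  \<open>t\<close> makes the exponent exactly \<open>- L\<close>.\<close>

lemma (in prob_space) sub_gamma_tail:
  assumes [measurable]: "Z \<in> borel_measurable M"
    and Z: "sub_gamma M Z v c" and v: "0 < v" and c: "0 \<le> c" and L: "0 < L"
  shows "prob {\<omega> \<in> space M. sqrt (2 * v * L) + c * L \<le> Z \<omega>} \<le> exp (- L)"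
proof -
  define a where "a = sqrt (2 * L / v)"
  have a0: "0 < a" using v L by (simp add: a_def)
  have a2: "v * a\<^sup>2 = 2 * L" using v L by (simp add: a_def)
  have "sqrt (2 * v * L) = sqrt (v\<^sup>2 * (2 * L / v))" using v by (simp add: power2_eq_square)
  then have va: "sqrt (2 * v * L) = v * a" using v by (simp only: real_sqrt_mult a_def) simp
  have d0: "0 < 1 + c * a" using a0 c by (simp add: add_pos_nonneg)
  \<comment> \<open>The minimiser of \<open>v t\<^sup>2 / (2 (1 - c t)) - t x\<close> for the threshold \<open>x\<close> defined below.\<close>
  define t where "t = a / (1 + c * a)"
  have t0: "0 < t" using a0 d0 by (simp add: t_def)
  have ct: "1 - c * t = 1 / (1 + c * a)" using d0 by (simp add: t_def field_simps)
  then have ct1: "c * t < 1" using d0 by (smt (verit) divide_pos_pos)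
  define x where "x = sqrt (2 * v * L) + c * L"
  have psi: "v * t\<^sup>2 / (2 * (1 - c * t)) = L / (1 + c * a)"
  proof -
    have "v * t\<^sup>2 / (2 * (1 - c * t)) = v * a\<^sup>2 / (2 * (1 + c * a))"
    proof -
      have "v * (a / d)\<^sup>2 / (2 * (1 / d)) = v * a\<^sup>2 / (2 * d)" if "0 < d" for d
        using that by (simp add: power2_eq_square)
      from this[OF d0] show ?thesis unfolding ct unfolding t_def .
    qed
    also have "\<dots> = L / (1 + c * a)" unfolding a2 by (rule mult_divide_mult_cancel_left) simp
    finally show ?thesis .
  qed
  have "t * x = (v * a\<^sup>2 + c * a * L) / (1 + c * a)"
    unfolding x_def va t_def by (simp add: power2_eq_square algebra_simps)
  then have "t * x = (L * (1 + c * a) + L) / (1 + c * a)" by (simp add: a2 algebra_simps)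
  also have "\<dots> = L + L / (1 + c * a)" using d0 by (simp add: add_divide_distrib)
  finally have tx: "t * x = L + L / (1 + c * a)" .
  have int: "integrable M (\<lambda>\<omega>. exp (t * Z \<omega>))"
    and mgf: "(\<integral>\<omega>. exp (t * Z \<omega>) \<partial>M) \<le> exp (L / (1 + c * a))"
    using Z[unfolded sub_gamma_def, rule_format, of t] t0 ct1 unfolding psi by auto
  have "prob {\<omega> \<in> space M. x \<le> Z \<omega>} = prob {\<omega> \<in> space M. exp (t * x) \<le> exp (t * Z \<omega>)}"
    using t0 by simp
  also have "\<dots> \<le> (\<integral>\<omega>. exp (t * Z \<omega>) \<partial>M) / exp (t * x)"
    by (rule integral_Markov_inequality_measure[OF int sets.empty_sets]) auto
  also have "\<dots> \<le> exp (L / (1 + c * a)) / exp (t * x)"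
    using mgf by (simp add: divide_right_mono)
  also have "\<dots> = exp (- L)" by (simp add: exp_diff[symmetric] tx)
  finally show ?thesis by (simp add: x_def)
qed

lemma (in prob_space) sub_gamma_centered:
  assumes W[measurable]: "W \<in> borel_measurable M"
    and bnd: "AE \<omega> in M. \<bar>W \<omega>\<bar> \<le> b" and mom: "(\<integral>\<omega>. (W \<omega>)\<^sup>2 \<partial>M) \<le> v"
  shows "sub_gamma M (\<lambda>\<omega>. a * (W \<omega> - (\<integral>\<omega>. W \<omega> \<partial>M))) (a\<^sup>2 * v) (\<bar>a\<bar> * (2 * b) / 3)"
proof (rule sub_gamma_bounded)
  let ?m = "\<integral>\<omega>. W \<omega> \<partial>M"
  have int: "integrable M W" using bnd by (intro integrable_const_bound[of W b]) auto
  have int2: "integrable M (\<lambda>\<omega>. (W \<omega>)\<^sup>2)"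
  proof (rule integrable_const_bound)
    show "AE \<omega> in M. norm ((W \<omega>)\<^sup>2) \<le> b\<^sup>2"
      using bnd by eventually_elim (simp add: abs_le_square_iff[symmetric])
  qed simp
  have "\<bar>?m\<bar> \<le> (\<integral>\<omega>. \<bar>W \<omega>\<bar> \<partial>M)" by (rule integral_abs_bound)
  also have "\<dots> \<le> (\<integral>\<omega>. b \<partial>M)" using int bnd by (intro integral_mono_AE) auto
  finally have m: "\<bar>?m\<bar> \<le> b" by (simp add: prob_space)
  show "AE \<omega> in M. \<bar>a * (W \<omega> - ?m)\<bar> \<le> \<bar>a\<bar> * (2 * b)"
    using bnd
  proof eventually_elim
    fix \<omega> assume "\<bar>W \<omega>\<bar> \<le> b"
    then have "\<bar>W \<omega> - ?m\<bar> \<le> 2 * b" using m by linarith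
    then show "\<bar>a * (W \<omega> - ?m)\<bar> \<le> \<bar>a\<bar> * (2 * b)"
      unfolding abs_mult by (rule mult_left_mono) simp
  qed
  show "(\<integral>\<omega>. a * (W \<omega> - ?m) \<partial>M) = 0" using int by (simp add: prob_space)
  have "(\<integral>\<omega>. (a * (W \<omega> - ?m))\<^sup>2 \<partial>M) = a\<^sup>2 * ((\<integral>\<omega>. (W \<omega>)\<^sup>2 \<partial>M) - ?m\<^sup>2)"
    using variance_eq[OF int int2] by (simp add: power_mult_distrib)
  moreover have "(\<integral>\<omega>. (W \<omega>)\<^sup>2 \<partial>M) - ?m\<^sup>2 \<le> v" using mom zero_le_power2[of ?m] by linarith
  then have "a\<^sup>2 * ((\<integral>\<omega>. (W \<omega>)\<^sup>2 \<partial>M) - ?m\<^sup>2) \<le> a\<^sup>2 * v" by (rule mult_left_mono) simp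
  ultimately show "(\<integral>\<omega>. (a * (W \<omega> - ?m))\<^sup>2 \<partial>M) \<le> a\<^sup>2 * v" by simp
qed simp

text \<open>Independence of two generated sigma-algebras passes to functions of the generators. The generators
  may take values in different types, but the functions have a common codomain type, as \<open>indep_var\<close> demands.\<close>

lemma (in prob_space) indep_var_compose_vimage_algebra:
  assumes g: "g \<in> measurable M G" and h: "h \<in> measurable M H"
    and indep: "indep_set (sets (vimage_algebra (space M) g G)) (sets (vimage_algebra (space M) h H))"
    and u: "u \<in> measurable G S" and w: "w \<in> measurable H T"
  shows "indep_var S (\<lambda>\<omega>. u (g \<omega>)) T (\<lambda>\<omega>. w (h \<omega>))"
proof -
  have sub: "sigma_sets (space M) {(\<lambda>\<omega>. f (k \<omega>)) -` A \<inter> space M | A. A \<in> sets L}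
      \<subseteq> sets (vimage_algebra (space M) k K)"
    if k: "k \<in> measurable M K" and f: "f \<in> measurable K L" for f k and K :: "'z measure" and L
  proof -
    have "k \<in> measurable (vimage_algebra (space M) k K) K"
      using measurable_space[OF k] by (intro measurable_vimage_algebra1) auto
    from measurable_sets[OF measurable_compose[OF this f]]
    have "{(\<lambda>\<omega>. f (k \<omega>)) -` A \<inter> space M | A. A \<in> sets L} \<subseteq> sets (vimage_algebra (space M) k K)"
      by auto
    from sets.sigma_sets_subset[OF this] show ?thesis by simp
  qed
  show ?thesis
    using indep sub[OF g u] sub[OF h w] measurable_compose[OF g u] measurable_compose[OF h w]
    unfolding indep_var_eq indep_sets2_eq by blast
qed

section \<open>Deterministic analysis of the transductive lasso\<close>

lemma Sigma_unlab_mult_vec: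
  fixes x :: "nat \<Rightarrow> real^'p"
  shows "Sigma_unlab n N x *v v = (1 / real (N - n)) *\<^sub>R (\<Sum>i=n+1..N. (x i \<bullet> v) *\<^sub>R x i)"
proof -
  have "(\<Sum>k\<in>UNIV. (\<Sum>i=n+1..N. x i $ j * x i $ k) / real (N - n) * v $ k)
      = (\<Sum>i=n+1..N. (x i \<bullet> v) * x i $ j) / real (N - n)" for j
    unfolding sum_divide_distrib sum_distrib_right inner_vec_def
    by (subst sum.swap) (simp add: mult_ac)
  then show ?thesis
    by (simp add: Sigma_unlab_def vec_eq_iff matrix_vector_mult_def sum_component)
qed

lemma inner_Sigma_unlab_mult_vec:
  "w \<bullet> (Sigma_unlab n N x *v v) = 1 / real (N - n) * (\<Sum>i=n+1..N. (x i \<bullet> w) * (x i \<bullet> v))"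
  by (simp add: Sigma_unlab_mult_vec inner_sum_right inner_commute mult.commute)

lemma psd_Sigma_unlab: "psd_matrix (Sigma_unlab n N x)"
  unfolding psd_matrix_def
proof
  show "transpose (Sigma_unlab n N x) = Sigma_unlab n N x"
    by (simp add: Sigma_unlab_def transpose_def vec_eq_iff sum_component mult.commute)
  show "\<forall>v. 0 \<le> v \<bullet> (Sigma_unlab n N x *v v)"
    by (simp add: inner_Sigma_unlab_mult_vec sum_nonneg)
qed

text \<open>The quadratic form of the Gram matrix of the unlabeled points.\<close>

definition unlab_sq_norm :: "nat \<Rightarrow> nat \<Rightarrow> (nat \<Rightarrow> real^'p) \<Rightarrow> real^'p \<Rightarrow> real" where
  "unlab_sq_norm n N x v = 1 / real (N - n) * (\<Sum>i=n+1..N. (x i \<bullet> v)\<^sup>2)"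

lemma norm_sqrt_Sigma_unlab:
  "(norm (matrix_sqrt (Sigma_unlab n N x) *v v))\<^sup>2 = unlab_sq_norm n N x v"
  unfolding norm_matrix_sqrt_mult[OF psd_Sigma_unlab] inner_Sigma_unlab_mult_vec
    unlab_sq_norm_def by (simp add: power2_eq_square)

text \<open>The difference between the labeled and the unlabeled estimate of \<open>E (Y X)\<close>. It carries all the
  randomness that the penalty has to dominate.\<close>

definition moment_gap ::
    "nat \<Rightarrow> nat \<Rightarrow> (real^'p \<Rightarrow> real) \<Rightarrow> (nat \<Rightarrow> real^'p) \<Rightarrow> (nat \<Rightarrow> real) \<Rightarrow> real^'p" where
  "moment_gap n N f x y = (1 / real n) *\<^sub>R (\<Sum>i=1..n. y i *\<^sub>R x i)
     - (1 / real (N - n)) *\<^sub>R (\<Sum>i=n+1..N. f (x i) *\<^sub>R x i)"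

text \<open>Expanding the risk produces the cross term \<open>- 2/(N - n) \<Sum> f (x i) (x i \<bullet> \<beta>)\<close>, whereas the objective
  contains its labeled counterpart; the difference of the two is the moment gap.\<close>

lemma lasso_objective_eq:
  "lasso_objective n N lam x y \<beta> = transductive_risk n N f x (linear_predictor \<beta>)
     - 1 / real (N - n) * (\<Sum>i=n+1..N. (f (x i))\<^sup>2)
     - 2 * (moment_gap n N f x y \<bullet> \<beta>) + 2 * lam * l1_norm \<beta>"
proof -
  have "transductive_risk n N f x (linear_predictor \<beta>) = unlab_sq_norm n N x \<beta>
      - 2 / real (N - n) * (\<Sum>i=n+1..N. f (x i) * (x i \<bullet> \<beta>))
      + 1 / real (N - n) * (\<Sum>i=n+1..N. (f (x i))\<^sup>2)"
    by (simp add: transductive_risk_def linear_predictor_def unlab_sq_norm_def power2_diff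
        sum.distrib sum_subtractf sum_distrib_left[symmetric] mult_ac add_divide_distrib diff_divide_distrib)
  then show ?thesis
    by (simp add: lasso_objective_def norm_sqrt_Sigma_unlab moment_gap_def inner_diff_left
        inner_sum_left algebra_simps)
qed

lemma l1_norm_nonneg: "0 \<le> l1_norm v"
  by (simp add: l1_norm_def sum_nonneg)

lemma abs_inner_le_l1_norm:
  fixes g v :: "real^'p"
  assumes "\<And>j. \<bar>g $ j\<bar> \<le> r"
  shows "\<bar>g \<bullet> v\<bar> \<le> r * l1_norm v"
proof -
  have "\<bar>g \<bullet> v\<bar> \<le> (\<Sum>j\<in>UNIV. \<bar>g $ j * v $ j\<bar>)"
    unfolding inner_vec_def inner_real_def by (rule sum_abs)
  also have "\<dots> \<le> (\<Sum>j\<in>UNIV. r * \<bar>v $ j\<bar>)"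
    by (intro sum_mono) (simp add: abs_mult assms mult_right_mono)
  finally show ?thesis by (simp add: l1_norm_def sum_distrib_left)
qed

text \<open>Labeled features may have a component in the kernel of the unlabeled Gram matrix, so the objective
  can be unbounded below in general. Half of \<open>lam\<close> absorbs the moment gap, and the other half makes the objective
  grow at least like \<open>lam * norm \<beta>\<close>.\<close>

lemma transductive_lasso_exists:
  fixes x :: "nat \<Rightarrow> real^'p"
  assumes lam: "0 < lam" and gap: "\<And>j. \<bar>moment_gap n N f x y $ j\<bar> \<le> lam / 2"
  shows "\<exists>\<beta>. is_transductive_lasso n N lam x y \<beta>"
proof -
  let ?F = "lasso_objective n N lam x y"
  define C where "C = 1 / real (N - n) * (\<Sum>i=n+1..N. (f (x i))\<^sup>2)"
  have C0: "0 \<le> C" by (simp add: C_def sum_nonneg)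
  have coercive: "lam * norm \<beta> - C \<le> ?F \<beta>" for \<beta>
  proof -
    have "moment_gap n N f x y \<bullet> \<beta> \<le> lam / 2 * l1_norm \<beta>"
      using abs_inner_le_l1_norm[OF gap, of \<beta>] by linarith
    moreover have "0 \<le> transductive_risk n N f x (linear_predictor \<beta>)"
      by (simp add: transductive_risk_def sum_nonneg)
    moreover have "lam * norm \<beta> \<le> lam * l1_norm \<beta>"
      using norm_le_l1_cart[of \<beta>] lam by (simp add: l1_norm_def)
    ultimately show ?thesis
      unfolding lasso_objective_eq[where f = f] C_def[symmetric] by (simp add: algebra_simps)
  qed
  have "continuous_on (cball 0 (C / lam)) ?F"
    unfolding lasso_objective_eq[where f = f, abs_def] transductive_risk_def linear_predictor_def l1_norm_def
    by (intro continuous_intros)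
  moreover have "cball (0 :: real^'p) (C / lam) \<noteq> {}" using divide_nonneg_pos[OF C0 lam] by simp
  ultimately obtain b where bmin: "\<And>\<beta>. \<beta> \<in> cball 0 (C / lam) \<Longrightarrow> ?F b \<le> ?F \<beta>"
    using continuous_attains_inf[OF compact_cball] by metis
  have "?F b \<le> ?F \<beta>" for \<beta>
  proof (cases "norm \<beta> \<le> C / lam")
    case True then show ?thesis using bmin by simp
  next
    case False
    have "?F b \<le> ?F 0" using bmin[of 0] divide_nonneg_pos[OF C0 lam] by simp
    also have "?F 0 = 0" by (simp add: lasso_objective_def l1_norm_def)
    also have "0 \<le> lam * norm \<beta> - C" using False lam by (simp add: field_simps)
    also have "\<dots> \<le> ?F \<beta>" by (rule coercive)
    finally show ?thesis .
  qed
  then show ?thesis by (auto simp: is_transductive_lasso_def is_arg_min_linorder)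
qed

text \<open>Comparing \<open>b\<close> with \<open>\<beta>\<close> alone would lose the quadratic term on the left. It appears when \<open>b\<close> is
  compared with \<open>b + t (\<beta> - b)\<close> and \<open>t\<close> tends to 0: the risk is a quadratic function of \<open>t\<close>, the penalty a convex
  one, and the curvature of the risk contributes \<open>(1 - t) Q\<close> after division by \<open>t\<close>.\<close>

lemma transductive_lasso_basic_inequality:
  fixes x :: "nat \<Rightarrow> real^'p"
  assumes lam: "0 \<le> lam" and opt: "is_transductive_lasso n N lam x y b"
  shows "transductive_risk n N f x (linear_predictor b) + unlab_sq_norm n N x (\<beta> - b)
    \<le> transductive_risk n N f x (linear_predictor \<beta>)
      - 2 * (moment_gap n N f x y \<bullet> (\<beta> - b)) + 2 * lam * (l1_norm \<beta> - l1_norm b)"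
proof -
  let ?E = "\<lambda>\<beta>. transductive_risk n N f x (linear_predictor \<beta>)"
  let ?Q = "unlab_sq_norm n N x (\<beta> - b)"
  define A where "A = ?E \<beta> - ?E b - 2 * (moment_gap n N f x y \<bullet> (\<beta> - b)) + 2 * lam * (l1_norm \<beta> - l1_norm b)"
  have "(1 - t) * ?Q \<le> A" if t: "0 < t" "t < 1" for t
  proof -
    define z where "z = b + t *\<^sub>R (\<beta> - b)"
    have "?E z = 1 / real (N - n) * (\<Sum>i=n+1..N. (1 - t) * (x i \<bullet> b - f (x i))\<^sup>2
        + t * (x i \<bullet> \<beta> - f (x i))\<^sup>2 - t * (1 - t) * (x i \<bullet> (\<beta> - b))\<^sup>2)"
      unfolding transductive_risk_def linear_predictor_def
      by (intro arg_cong2[where f = "(*)"] sum.cong refl)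
        (simp add: z_def inner_add_right inner_diff_right power2_eq_square algebra_simps)
    also have "\<dots> = (1 - t) * ?E b + t * ?E \<beta> - t * (1 - t) * ?Q"
      by (simp add: transductive_risk_def linear_predictor_def unlab_sq_norm_def sum.distrib
          sum_subtractf sum_distrib_left[symmetric] add_divide_distrib diff_divide_distrib)
    finally have E: "?E z = (1 - t) * ?E b + t * ?E \<beta> - t * (1 - t) * ?Q" .
    have "l1_norm z \<le> (\<Sum>j\<in>UNIV. (1 - t) * \<bar>b $ j\<bar> + t * \<bar>\<beta> $ j\<bar>)"
      unfolding l1_norm_def
    proof (rule sum_mono)
      fix j
      have "z $ j = (1 - t) * b $ j + t * \<beta> $ j" by (simp add: z_def algebra_simps)
      then show "\<bar>z $ j\<bar> \<le> (1 - t) * \<bar>b $ j\<bar> + t * \<bar>\<beta> $ j\<bar>"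
        using t abs_triangle_ineq[of "(1 - t) * b $ j" "t * \<beta> $ j"] by (simp add: abs_mult)
    qed
    then have L: "l1_norm z \<le> (1 - t) * l1_norm b + t * l1_norm \<beta>"
      by (simp add: l1_norm_def sum.distrib sum_distrib_left)
    have "lasso_objective n N lam x y b \<le> lasso_objective n N lam x y z"
      using opt by (simp add: is_transductive_lasso_def is_arg_min_linorder)
    moreover have "2 * lam * l1_norm z \<le> 2 * lam * ((1 - t) * l1_norm b + t * l1_norm \<beta>)"
      using L lam by (intro mult_left_mono) auto
    moreover have "moment_gap n N f x y \<bullet> z
        = moment_gap n N f x y \<bullet> b + t * (moment_gap n N f x y \<bullet> (\<beta> - b))"
      by (simp add: z_def inner_add_right)
    ultimately have "0 \<le> t * (A - (1 - t) * ?Q)"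
      unfolding lasso_objective_eq[where f = f] E A_def by (simp add: algebra_simps)
    then show ?thesis using t by (simp add: zero_le_mult_iff)
  qed
  then have "eventually (\<lambda>t. (1 - t) * ?Q \<le> A) (at_right 0)"
    by (intro eventually_at_rightI[of 0 1]) auto
  moreover have "((\<lambda>t. (1 - t) * ?Q) \<longlongrightarrow> (1 - 0) * ?Q) (at_right 0)"
    by (intro tendsto_intros)
  ultimately have "?Q \<le> A"
    using tendsto_upperbound[of "\<lambda>t. (1 - t) * ?Q" _ "at_right 0" A] by simp
  then show ?thesis by (simp add: A_def)
qed

text \<open>Coordinatewise triangle inequality: on \<open>J\<close> use \<open>|\<beta> j| - |b j| \<le> |\<beta> j - b j|\<close>, off \<open>J\<close> use
  \<open>|b j| \<ge> |\<beta> j - b j| - |\<beta> j|\<close>. This is where the constant 3 in the compatibility constant comes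
  from.\<close>

lemma l1_norm_slack:
  fixes b \<beta> :: "real^'p"
  shows "l1_norm (\<beta> - b) + 2 * (l1_norm \<beta> - l1_norm b) \<le> 4 * l1_norm (restrict_vec (- J) \<beta>)
     + (3 * l1_norm (restrict_vec J (\<beta> - b)) - l1_norm (restrict_vec (- J) (\<beta> - b)))"
  unfolding l1_norm_def sum_distrib_left sum_subtractf[symmetric] sum.distrib[symmetric]
proof (rule sum_mono)
  fix j
  show "\<bar>(\<beta> - b) $ j\<bar> + 2 * (\<bar>\<beta> $ j\<bar> - \<bar>b $ j\<bar>) \<le> 4 * \<bar>restrict_vec (- J) \<beta> $ j\<bar>
     + (3 * \<bar>restrict_vec J (\<beta> - b) $ j\<bar> - \<bar>restrict_vec (- J) (\<beta> - b) $ j\<bar>)"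
    by (cases "j \<in> J") (simp_all add: restrict_vec_def abs_if)
qed

lemma compatibility_constant_nonneg: "0 \<le> compatibility_constant A J c"
  by (simp add: compatibility_constant_def le_INF_iff)

text \<open>For \<open>T > 0\<close> the vector \<open>v\<close> competes in the infimum that defines the compatibility constant \<open>\<kappa>\<close>, hence
  \<open>Q \<ge> \<kappa> T\<^sup>2 / (9 |J|)\<close> for \<open>Q\<close> the squared norm, and \<open>lam T - \<kappa> T\<^sup>2 / (9 |J|)\<close>
  is maximal at \<open>T = 9 |J| lam / (2 \<kappa>)\<close> if \<open>\<kappa> > 0\<close>; if \<open>\<kappa> = 0\<close> the right-hand side
  is infinite. For \<open>T \<le> 0\<close> the left-hand side is nonpositive.\<close>

lemma compatibility_tradeoff:
  fixes A :: "real^'p^'p" and v :: "real^'p" and J :: "'p set"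
  assumes lam: "0 < lam"
  defines "T \<equiv> 3 * l1_norm (restrict_vec J v) - l1_norm (restrict_vec (- J) v)"
  shows "ereal (lam * T - (norm (matrix_sqrt A *v v))\<^sup>2)
    \<le> ereal (9 * lam\<^sup>2 * real (card J)) / (4 * compatibility_constant A J 3)"
proof (cases "T \<le> 0")
  case True
  then have "lam * T \<le> 0" using lam by (simp add: mult_nonneg_nonpos)
  then have "ereal (lam * T - (norm (matrix_sqrt A *v v))\<^sup>2) \<le> 0"
    by (simp add: zero_ereal_def) (smt (verit) zero_le_power2)
  also have "0 \<le> ereal (9 * lam\<^sup>2 * real (card J)) / (4 * compatibility_constant A J 3)"
    using compatibility_constant_nonneg[of A J 3] by (simp add: zero_le_divide_ereal)
  finally show ?thesis .
next
  case False
  define Q where "Q = (norm (matrix_sqrt A *v v))\<^sup>2"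
  define \<kappa> where "\<kappa> = compatibility_constant A J 3"
  define c where "c = 9 * real (card J)"
  have le: "\<kappa> \<le> ereal (c * Q / T\<^sup>2)"
    unfolding \<kappa>_def compatibility_constant_def c_def Q_def T_def
    by (rule INF_lower2[of v]) (use False in \<open>auto simp: T_def\<close>)
  have "J \<noteq> {}"
  proof
    assume "J = {}"
    then have "l1_norm (restrict_vec J v) = 0" by (simp add: l1_norm_def restrict_vec_def)
    then show False using False l1_norm_nonneg[of "restrict_vec (- J) v"] by (simp add: T_def)
  qed
  then have c: "0 < c" by (simp add: c_def card_gt_0_iff)
  obtain k where k: "\<kappa> = ereal k" "0 \<le> k"
    using le compatibility_constant_nonneg[of A J 3] by (cases \<kappa>) (auto simp: \<kappa>_def)
  show ?thesis
  proof (cases "k = 0")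
    case True
    then have "ereal (9 * lam\<^sup>2 * real (card J)) / (4 * \<kappa>) = \<infinity>"
      using c lam k \<open>J \<noteq> {}\<close> by (simp add: divide_ereal_def c_def)
    then show ?thesis by (simp add: \<kappa>_def)
  next
    case False
    with k have kpos: "0 < k" by simp
    have T2: "0 < T\<^sup>2" using \<open>\<not> T \<le> 0\<close> by simp
    have "k * T\<^sup>2 \<le> c * Q" using le k T2 by (simp add: pos_le_divide_eq)
    then have "k * T\<^sup>2 / c \<le> Q" using c by (simp add: field_simps)
    moreover have "lam * T - k * T\<^sup>2 / c \<le> c * lam\<^sup>2 / (4 * k)"
    proof -
      have "c * lam\<^sup>2 / (4 * k) - (lam * T - k * T\<^sup>2 / c) = (2 * k * T - c * lam)\<^sup>2 / (4 * k * c)"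
        using c kpos by (simp add: field_simps power2_eq_square)
      also have "\<dots> \<ge> 0" using c kpos by simp
      finally show ?thesis by simp
    qed
    ultimately have "lam * T - Q \<le> c * lam\<^sup>2 / (4 * k)" by linarith
    moreover have "4 * \<kappa> = ereal (4 * k)" by (simp add: k)
    ultimately show ?thesis
      using kpos by (simp add: \<kappa>_def[symmetric] Q_def c_def mult_ac)
  qed
qed

lemma transductive_lasso_oracle_inequality:
  fixes x :: "nat \<Rightarrow> real^'p"
  assumes lam: "0 < lam" and gap: "\<And>j. \<bar>moment_gap n N f x y $ j\<bar> \<le> lam / 2"
    and opt: "is_transductive_lasso n N lam x y b"
  shows "ereal (transductive_risk n N f x (linear_predictor b))
    \<le> ereal (transductive_risk n N f x (linear_predictor \<beta>) + 4 * lam * l1_norm (restrict_vec (- J) \<beta>))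
      + ereal (9 * lam\<^sup>2 * real (card J)) / (4 * compatibility_constant (Sigma_unlab n N x) J 3)"
proof -
  let ?E = "\<lambda>\<beta>. transductive_risk n N f x (linear_predictor \<beta>)"
  let ?T = "3 * l1_norm (restrict_vec J (\<beta> - b)) - l1_norm (restrict_vec (- J) (\<beta> - b))"
  let ?Q = "(norm (matrix_sqrt (Sigma_unlab n N x) *v (\<beta> - b)))\<^sup>2"
  have "?E b + ?Q \<le> ?E \<beta> - 2 * (moment_gap n N f x y \<bullet> (\<beta> - b)) + 2 * lam * (l1_norm \<beta> - l1_norm b)"
    unfolding norm_sqrt_Sigma_unlab using lam opt by (intro transductive_lasso_basic_inequality) auto
  also have "\<dots> \<le> ?E \<beta> + lam * (l1_norm (\<beta> - b) + 2 * (l1_norm \<beta> - l1_norm b))"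
    using abs_inner_le_l1_norm[OF gap, of "\<beta> - b"] unfolding distrib_left by linarith
  also have "\<dots> \<le> ?E \<beta> + lam * (4 * l1_norm (restrict_vec (- J) \<beta>) + ?T)"
    using lam l1_norm_slack[of \<beta> b J] by simp
  finally have "ereal (?E b) \<le> ereal (?E \<beta> + 4 * lam * l1_norm (restrict_vec (- J) \<beta>)) + ereal (lam * ?T - ?Q)"
    by (simp add: algebra_simps)
  also have "\<dots> \<le> ereal (?E \<beta> + 4 * lam * l1_norm (restrict_vec (- J) \<beta>))
      + ereal (9 * lam\<^sup>2 * real (card J)) / (4 * compatibility_constant (Sigma_unlab n N x) J 3)"
    by (intro add_left_mono compatibility_tradeoff lam)
  finally show ?thesis .
qed

section \<open>Concentration of the moment gap\<close>

lemma borel_measurable_vec_nth: "(\<lambda>x :: real^'p. x $ j) \<in> borel_measurable borel"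
  by (intro borel_measurable_continuous_onI continuous_intros)

lemma bounded_byD:
  fixes P :: "((real^'p) \<times> real) measure"
  assumes "prob_space P" and bnd: "bounded_by P B_Y B_X"
  shows "AE z in P. \<bar>snd z\<bar> \<le> B_Y" and "AE z in P. \<bar>fst z $ j\<bar> \<le> B_X" and "0 \<le> B_Y" and "0 \<le> B_X"
proof -
  interpret prob_space P by fact
  have AE: "AE z in P. \<bar>snd z\<bar> \<le> B_Y \<and> (MAX j. \<bar>fst z $ j\<bar>) \<le> B_X"
    using AE_prob_1[OF bnd[unfolded bounded_by_def]] by eventually_elim simp
  have le: "\<bar>z $ k\<bar> \<le> (MAX j. \<bar>z $ j\<bar>)" for z :: "real^'p" and k
    by (rule Max_ge) auto
  show Y: "AE z in P. \<bar>snd z\<bar> \<le> B_Y" using AE by eventually_elim simp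
  show X: "AE z in P. \<bar>fst z $ j\<bar> \<le> B_X" for j
    using AE by eventually_elim (use le order_trans in blast)
  obtain z where "\<bar>snd z\<bar> \<le> B_Y" using eventually_happens'[OF ae_filter_bot Y] by auto
  then show "0 \<le> B_Y" by linarith
  obtain z :: "(real^'p) \<times> real" where "\<bar>fst z $ undefined\<bar> \<le> B_X" using eventually_happens'[OF ae_filter_bot X[of undefined]] by auto
  then show "0 \<le> B_X" by linarith
qed

lemma bounded_by_mono:
  fixes P :: "((real^'p) \<times> real) measure"
  assumes "prob_space P" and sets: "sets P = sets borel" and bnd: "bounded_by P B B_X" and "B \<le> B'"
  shows "bounded_by P B' B_X"
proof -
  interpret prob_space P by fact
  have sp: "space P = UNIV" using sets_eq_imp_space_eq[OF sets] by simp
  have "AE z in P. \<bar>snd z\<bar> \<le> B \<and> (MAX j. \<bar>fst z $ j\<bar>) \<le> B_X"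
    using AE_prob_1[OF bnd[unfolded bounded_by_def]] by eventually_elim simp
  then have "AE z in P. \<bar>snd z\<bar> \<le> B' \<and> (MAX j. \<bar>fst z $ j\<bar>) \<le> B_X"
    by eventually_elim (use \<open>B \<le> B'\<close> in auto)
  moreover have "{z \<in> space P. \<bar>snd z\<bar> \<le> B' \<and> (MAX j. \<bar>fst z $ j\<bar>) \<le> B_X} \<in> sets P"
  proof -
    have "{z \<in> space P. \<bar>snd z\<bar> \<le> B' \<and> (MAX j. \<bar>fst z $ j\<bar>) \<le> B_X}
        = {z :: (real^'p) \<times> real. \<bar>snd z\<bar> \<le> B'} \<inter> (\<Inter>j. {z. \<bar>fst z $ j\<bar> \<le> B_X})"
      by (auto simp: sp)
    also have "closed \<dots>"
      by (intro closed_Int closed_INT ballI closed_Collect_le continuous_intros)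
    then have "\<dots> \<in> sets borel" by (rule borel_closed)
    finally show ?thesis by (simp add: sets)
  qed
  ultimately show ?thesis unfolding bounded_by_def by (subst prob_Collect_eq_1) auto
qed

text \<open>Composed with the features, the regression function is a conditional expectation of the label; so it
  inherits bounds on the label and has the same integral against functions of the features.\<close>

lemma
  fixes P :: "((real^'p) \<times> real) measure"
  assumes "prob_space P" and sets: "sets P = sets borel" and reg: "is_regression_function P f"
    and bnd: "AE z in P. \<bar>snd z\<bar> \<le> B"
  shows regression_function_bounded: "AE z in P. \<bar>f (fst z)\<bar> \<le> B"
    and regression_function_moment: "integrable P (\<lambda>z. snd z * fst z $ j) \<Longrightarrow>
      (\<integral>z. f (fst z) * fst z $ j \<partial>P) = (\<integral>z. snd z * fst z $ j \<partial>P)"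
proof -
  interpret prob_space P by fact
  have fst_meas: "fst \<in> measurable P borel" and [measurable]: "snd \<in> borel_measurable P"
    unfolding measurable_cong_sets[OF sets refl]
    by (auto intro!: borel_measurable_continuous_onI continuous_intros)
  note fst_meas[measurable]
  define F where "F = vimage_algebra (space P) (fst :: _ \<Rightarrow> real^'p) borel"
  have fstF: "fst \<in> measurable F borel"
    unfolding F_def by (rule measurable_vimage_algebra1) simp
  have "subalgebra P F"
    using measurable_sets[OF fst_meas] by (auto simp: subalgebra_def F_def sets_vimage_algebra2)
  then interpret finite_measure_subalgebra P F by unfold_locales
  have [measurable]: "f \<in> borel_measurable borel"
    and ce: "AE z in P. f (fst z) = real_cond_exp P F snd z"
    using reg by (auto simp: is_regression_function_def F_def)
  have int: "integrable P snd" using bnd by (intro integrable_const_bound[of snd B]) auto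
  have up: "AE z in P. snd z \<le> B" and lo: "AE z in P. - B \<le> snd z"
    using bnd by (eventually_elim, linarith)+
  show "AE z in P. \<bar>f (fst z)\<bar> \<le> B"
    using ce real_cond_exp_le_c[OF int up] real_cond_exp_ge_c[OF int lo]
    by eventually_elim linarith
  assume "integrable P (\<lambda>z. snd z * fst z $ j)"
  then have "integrable P (\<lambda>z. fst z $ j * snd z)" by (simp add: mult.commute)
  moreover have "(\<lambda>z. fst z $ j) \<in> borel_measurable F"
    by (rule measurable_compose[OF fstF borel_measurable_vec_nth])
  ultimately have "(\<integral>z. fst z $ j * real_cond_exp P F snd z \<partial>P) = (\<integral>z. fst z $ j * snd z \<partial>P)"
    by (intro real_cond_exp_intg(2)) auto
  moreover have [measurable]: "(\<lambda>z. fst z $ j) \<in> borel_measurable P"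
    by (rule measurable_compose[OF fst_meas borel_measurable_vec_nth])
  have "(\<integral>z. f (fst z) * fst z $ j \<partial>P) = (\<integral>z. fst z $ j * real_cond_exp P F snd z \<partial>P)"
    using ce by (intro integral_cong_AE) auto
  ultimately show "(\<integral>z. f (fst z) * fst z $ j \<partial>P) = (\<integral>z. snd z * fst z $ j \<partial>P)"
    by (simp add: mult.commute)
qed

text \<open>Used with \<open>g\<close> the label and with \<open>g\<close> the regression function at the features. Normalised features make \<open>B_Y\<^sup>2\<close> a
  bound on the second moment of the product, while \<open>B_X\<close> enters only the scale.\<close>

lemma sub_gamma_label_feature_product:
  fixes P :: "((real^'p) \<times> real) measure"
  assumes "prob_space P" and sets: "sets P = sets borel"
    and cn: "centered_normalized P" and bnd: "bounded_by P B_Y B_X"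
    and G[measurable]: "g \<in> borel_measurable P" and g: "AE z in P. \<bar>g z\<bar> \<le> B_Y"
  shows "sub_gamma P (\<lambda>z. a * (g z * fst z $ j - (\<integral>z. g z * fst z $ j \<partial>P)))
    (a\<^sup>2 * B_Y\<^sup>2) (\<bar>a\<bar> * (2 * (B_Y * B_X)) / 3)"
proof -
  interpret prob_space P by fact
  have meas[measurable]: "(\<lambda>z. fst z $ j) \<in> borel_measurable P"
    unfolding measurable_cong_sets[OF sets refl]
    by (intro borel_measurable_continuous_onI continuous_intros)
  note B0 = bounded_byD(3,4)[OF \<open>prob_space P\<close> bnd]
  have x2: "integrable P (\<lambda>z. (fst z $ j)\<^sup>2)" "(\<integral>z. (fst z $ j)\<^sup>2 \<partial>P) = 1"
    using cn by (auto simp: centered_normalized_def)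
  have ae: "AE z in P. \<bar>g z * fst z $ j\<bar> \<le> B_Y * B_X"
    using g bounded_byD(2)[OF \<open>prob_space P\<close> bnd, of j]
    by eventually_elim (use B0 in \<open>simp add: abs_mult mult_mono\<close>)
  show ?thesis
  proof (rule sub_gamma_centered[OF _ ae])
    have "(\<integral>z. (g z * fst z $ j)\<^sup>2 \<partial>P) \<le> (\<integral>z. B_Y\<^sup>2 * (fst z $ j)\<^sup>2 \<partial>P)"
    proof (rule integral_mono_AE)
      show le: "AE z in P. (g z * fst z $ j)\<^sup>2 \<le> B_Y\<^sup>2 * (fst z $ j)\<^sup>2"
        using g
      proof eventually_elim
        fix z assume "\<bar>g z\<bar> \<le> B_Y"
        then have "(g z)\<^sup>2 \<le> B_Y\<^sup>2" using B0 by (simp add: abs_le_square_iff[symmetric])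
        then show "(g z * fst z $ j)\<^sup>2 \<le> B_Y\<^sup>2 * (fst z $ j)\<^sup>2"
          unfolding power_mult_distrib by (rule mult_right_mono) simp
      qed
      show int: "integrable P (\<lambda>z. B_Y\<^sup>2 * (fst z $ j)\<^sup>2)" using x2 by simp
      show "integrable P (\<lambda>z. (g z * fst z $ j)\<^sup>2)"
        by (rule Bochner_Integration.integrable_bound[OF int]) (use le in auto)
    qed
    also have "\<dots> = B_Y\<^sup>2" by (simp add: x2)
    finally show "(\<integral>z. (g z * fst z $ j)\<^sup>2 \<partial>P) \<le> B_Y\<^sup>2" .
  qed simp
qed

lemma moment_gap_nth:
  "moment_gap n N f x y $ j = 1 / real n * (\<Sum>i=1..n. y i * x i $ j)
     - 1 / real (N - n) * (\<Sum>i=n+1..N. f (x i) * x i $ j)"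
  by (simp add: moment_gap_def sum_component)

lemma moment_gap_measurable:
  fixes X :: "nat \<Rightarrow> 'a \<Rightarrow> real^'p"
  assumes sample: "semisupervised_sample M P n N X Y" and "n < N"
    and f: "f \<in> borel_measurable borel"
  shows "(\<lambda>\<omega>. moment_gap n N f (\<lambda>i. X i \<omega>) (\<lambda>i. Y i \<omega>) $ j) \<in> borel_measurable M"
proof -
  have X: "X i \<in> borel_measurable M" if "i \<in> {1..N}" for i
    using sample that by (auto simp: semisupervised_sample_def)
  have Y: "Y i \<in> borel_measurable M" if "i \<in> {1..n}" for i
    using sample that by (auto simp: semisupervised_sample_def)
  have Xj: "(\<lambda>\<omega>. X i \<omega> $ j) \<in> borel_measurable M" if "i \<in> {1..N}" for i
    by (rule measurable_compose[OF X[OF that] borel_measurable_vec_nth])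
  have fX: "(\<lambda>\<omega>. f (X i \<omega>)) \<in> borel_measurable M" if "i \<in> {1..N}" for i
    using measurable_compose[OF X[OF that] f] .
  show ?thesis
    unfolding moment_gap_nth using \<open>n < N\<close>
    by (intro borel_measurable_diff borel_measurable_times borel_measurable_const borel_measurable_sum Xj fX Y) auto
qed

text \<open>The sign \<open>\<sigma>\<close> selects the tail. The means of both blocks equal \<open>\<mu>\<close> and cancel, which turns the moment
  gap into a sum of centred independent terms with weights \<open>\<sigma> / n\<close> and \<open>- \<sigma> / (N - n)\<close>. These weights
  are at most \<open>1 / min n (N - n)\<close> in absolute value, and their squares sum to
  \<open>1 / n + 1 / (N - n) \<le> 2 / min n (N - n)\<close>.\<close>

lemma moment_gap_sub_gamma:
  fixes X :: "nat \<Rightarrow> 'a \<Rightarrow> real^'p" and P :: "((real^'p) \<times> real) measure"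
  assumes "prob_space M" and "prob_space P" and sets: "sets P = sets borel"
    and n: "1 \<le> n" "n < N"
    and sample: "semisupervised_sample M P n N X Y"
    and reg: "is_regression_function P f"
    and cn: "centered_normalized P"
    and bnd: "bounded_by P B_Y B_X"
    and \<sigma>: "\<bar>\<sigma>\<bar> = 1"
  shows "sub_gamma M (\<lambda>\<omega>. \<sigma> * moment_gap n N f (\<lambda>i. X i \<omega>) (\<lambda>i. Y i \<omega>) $ j)
    (2 * B_Y\<^sup>2 / real (min n (N - n))) (2 * (B_Y * B_X) / (3 * real (min n (N - n))))"
proof -
  interpret prob_space M by fact
  interpret P: prob_space P by fact
  define m where "m = N - n"
  define k where "k = min n m"
  have pos: "0 < real n" "0 < real m" "0 < real k" using n by (auto simp: m_def k_def)
  note Y_bnd = bounded_byD(1)[OF \<open>prob_space P\<close> bnd] and X_bnd = bounded_byD(2)[OF \<open>prob_space P\<close> bnd]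
    and B0 = bounded_byD(3,4)[OF \<open>prob_space P\<close> bnd]
  have f[measurable]: "f \<in> borel_measurable borel" using reg by (simp add: is_regression_function_def)
  have fst_P: "fst \<in> measurable P borel" and snd_P: "snd \<in> borel_measurable P"
    unfolding measurable_cong_sets[OF sets refl]
    by (auto intro!: borel_measurable_continuous_onI continuous_intros)
  have fstj_P: "(\<lambda>z. fst z $ j) \<in> borel_measurable P" 
    by (rule measurable_compose[OF fst_P borel_measurable_vec_nth])
  have pair_meas: "(\<lambda>z :: (real^'p) \<times> real. a * (snd z * fst z $ j - c)) \<in> borel_measurable borel" for a c
    by (intro borel_measurable_continuous_onI continuous_intros)
  have feat_meas: "(\<lambda>x :: real^'p. a * (f x * x $ j - c)) \<in> borel_measurable borel" for a c
    by (intro borel_measurable_times borel_measurable_diff borel_measurable_const f borel_measurable_vec_nth)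

  define \<mu> where "\<mu> = (\<integral>z. snd z * fst z $ j \<partial>P)"
  have "integrable P (\<lambda>z. snd z * fst z $ j)"
  proof (rule P.integrable_const_bound)
    show "AE z in P. norm (snd z * fst z $ j) \<le> B_Y * B_X"
      using Y_bnd X_bnd[of j] by eventually_elim (use B0 in \<open>simp add: abs_mult mult_mono\<close>)
    show "(\<lambda>z. snd z * fst z $ j) \<in> borel_measurable P"
      using snd_P fstj_P by (rule borel_measurable_times)
  qed
  then have \<mu>_f: "(\<integral>z. f (fst z) * fst z $ j \<partial>P) = \<mu>"
    unfolding \<mu>_def by (rule regression_function_moment[OF \<open>prob_space P\<close> sets reg Y_bnd])
  define c where "c = 2 * (B_Y * B_X) / (3 * real k)"
  have c_le: "\<bar>a\<bar> * (2 * (B_Y * B_X)) / 3 \<le> c" if "\<bar>a\<bar> \<le> 1 / real k" for a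
  proof -
    have "\<bar>a\<bar> * (2 * (B_Y * B_X)) / 3 \<le> 1 / real k * (2 * (B_Y * B_X)) / 3"
      using that B0 by (intro divide_right_mono mult_right_mono) auto
    then show ?thesis by (simp add: c_def mult.commute)
  qed

  define a where "a = \<sigma> / real n"
  define a' where "a' = - \<sigma> / real m"
  have abs_a: "\<bar>a\<bar> \<le> 1 / real k" "\<bar>a'\<bar> \<le> 1 / real k"
    using \<sigma> pos by (auto simp: a_def a'_def abs_divide k_def intro!: divide_left_mono)
  have a2: "a\<^sup>2 = 1 / (real n)\<^sup>2" "a'\<^sup>2 = 1 / (real m)\<^sup>2"
    using \<sigma> by (auto simp: a_def a'_def power_divide power2_eq_1_iff abs_if split: if_splits)
  have "sub_gamma P (\<lambda>z. a * (snd z * fst z $ j - \<mu>)) (a\<^sup>2 * B_Y\<^sup>2) (\<bar>a\<bar> * (2 * (B_Y * B_X)) / 3)"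
    unfolding \<mu>_def
    by (rule sub_gamma_label_feature_product[OF \<open>prob_space P\<close> sets cn bnd snd_P Y_bnd])
  then have lab_P: "sub_gamma P (\<lambda>z. a * (snd z * fst z $ j - \<mu>)) (a\<^sup>2 * B_Y\<^sup>2) c"
    by (rule sub_gamma_mono) (use c_le abs_a in auto)
  have "sub_gamma P (\<lambda>z. a' * (f (fst z) * fst z $ j - \<mu>)) (a'\<^sup>2 * B_Y\<^sup>2) (\<bar>a'\<bar> * (2 * (B_Y * B_X)) / 3)"
    unfolding \<mu>_f[symmetric]
    by (rule sub_gamma_label_feature_product[OF \<open>prob_space P\<close> sets cn bnd measurable_compose[OF fst_P f]
          regression_function_bounded[OF \<open>prob_space P\<close> sets reg Y_bnd]])
  then have unlab_P: "sub_gamma P (\<lambda>z. a' * (f (fst z) * fst z $ j - \<mu>)) (a'\<^sup>2 * B_Y\<^sup>2) c"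
    by (rule sub_gamma_mono) (use c_le abs_a in auto)

  define g where "g = (\<lambda>\<omega>. \<lambda>i\<in>{1..n}. (X i \<omega>, Y i \<omega>))"
  define h where "h = (\<lambda>\<omega>. \<lambda>i\<in>{n+1..N}. X i \<omega>)"
  have X: "X i \<in> borel_measurable M" if "i \<in> {1..N}" for i
    using sample that by (auto simp: semisupervised_sample_def)
  have XY: "(\<lambda>\<omega>. (X i \<omega>, Y i \<omega>)) \<in> borel_measurable M" if "i \<in> {1..n}" for i
    using sample that n by (intro borel_measurable_Pair) (auto simp: semisupervised_sample_def)
  have g: "g \<in> measurable M (PiM {1..n} (\<lambda>_. borel))"
    unfolding g_def by (intro measurable_restrict XY)
  have h: "h \<in> measurable M (PiM {n+1..N} (\<lambda>_. borel))"
    unfolding h_def by (intro measurable_restrict X) auto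
  let ?Z = "\<lambda>i \<omega>. a * (Y i \<omega> * X i \<omega> $ j - \<mu>)" and ?Z' = "\<lambda>i \<omega>. a' * (f (X i \<omega>) * X i \<omega> $ j - \<mu>)"

  have lab: "sub_gamma M (\<lambda>\<omega>. \<Sum>i=1..n. ?Z i \<omega>) (\<Sum>i=1..n. a\<^sup>2 * B_Y\<^sup>2) c"
  proof (rule sub_gamma_sum)
    have "indep_vars (\<lambda>_. borel) (\<lambda>i \<omega>. (X i \<omega>, Y i \<omega>)) {1..n}"
      using sample by (simp add: semisupervised_sample_def)
    from indep_vars_compose2[OF this pair_meas] show "indep_vars (\<lambda>_. borel) ?Z {1..n}" by simp
    fix i assume i: "i \<in> {1..n}"
    then have "distr M borel (\<lambda>\<omega>. (X i \<omega>, Y i \<omega>)) = P"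
      using sample by (simp add: semisupervised_sample_def)
    with lab_P have "sub_gamma (distr M borel (\<lambda>\<omega>. (X i \<omega>, Y i \<omega>))) (\<lambda>z. a * (snd z * fst z $ j - \<mu>)) (a\<^sup>2 * B_Y\<^sup>2) c"
      by simp
    then show "sub_gamma M (?Z i) (a\<^sup>2 * B_Y\<^sup>2) c"
      unfolding sub_gamma_distr[OF XY[OF i] pair_meas] by simp
  qed simp
  have unlab: "sub_gamma M (\<lambda>\<omega>. \<Sum>i=n+1..N. ?Z' i \<omega>) (\<Sum>i=n+1..N. a'\<^sup>2 * B_Y\<^sup>2) c"
  proof (rule sub_gamma_sum)
    have "indep_vars (\<lambda>_. borel) X {n+1..N}"
      using sample by (simp add: semisupervised_sample_def)
    from indep_vars_compose2[OF this feat_meas] show "indep_vars (\<lambda>_. borel) ?Z' {n+1..N}" .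
    fix i assume i: "i \<in> {n+1..N}"
    then have "distr M borel (X i) = distr P borel fst"
      using sample by (simp add: semisupervised_sample_def)
    moreover have "sub_gamma (distr P borel fst) (\<lambda>x. a' * (f x * x $ j - \<mu>)) (a'\<^sup>2 * B_Y\<^sup>2) c"
      unfolding sub_gamma_distr[OF fst_P feat_meas] by (rule unlab_P)
    ultimately have "sub_gamma (distr M borel (X i)) (\<lambda>x. a' * (f x * x $ j - \<mu>)) (a'\<^sup>2 * B_Y\<^sup>2) c"
      by simp
    moreover have "i \<in> {1..N}" using i by simp
    ultimately show "sub_gamma M (?Z' i) (a'\<^sup>2 * B_Y\<^sup>2) c"
      using sub_gamma_distr[OF X feat_meas] by blast
  qed simp
  have indep: "indep_var borel (\<lambda>\<omega>. \<Sum>i=1..n. ?Z i \<omega>) borel (\<lambda>\<omega>. \<Sum>i=n+1..N. ?Z' i \<omega>)"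
  proof -
    have "(\<lambda>q. \<Sum>i=1..n. a * (snd (q i) * fst (q i) $ j - \<mu>)) \<in> borel_measurable (PiM {1..n} (\<lambda>_. borel :: ((real^'p) \<times> real) measure))"
      by (intro borel_measurable_sum)
        (rule measurable_compose[OF measurable_component_singleton[where M = "\<lambda>_. borel"] pair_meas])
    moreover have "(\<lambda>q. \<Sum>i=n+1..N. a' * (f (q i) * q i $ j - \<mu>)) \<in> borel_measurable (PiM {n+1..N} (\<lambda>_. borel :: (real^'p) measure))"
      by (intro borel_measurable_sum)
        (rule measurable_compose[OF measurable_component_singleton[where M = "\<lambda>_. borel"] feat_meas])
    moreover have "indep_set (sets (vimage_algebra (space M) g (PiM {1..n} (\<lambda>_. borel))))
        (sets (vimage_algebra (space M) h (PiM {n+1..N} (\<lambda>_. borel))))"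
      using sample by (simp add: semisupervised_sample_def g_def h_def)
    ultimately have "indep_var borel (\<lambda>\<omega>. \<Sum>i=1..n. a * (snd (g \<omega> i) * fst (g \<omega> i) $ j - \<mu>))
        borel (\<lambda>\<omega>. \<Sum>i=n+1..N. a' * (f (h \<omega> i) * h \<omega> i $ j - \<mu>))"
      by (intro indep_var_compose_vimage_algebra[OF g h])
    then show ?thesis by (simp add: g_def h_def)
  qed

  have "sub_gamma M (\<lambda>\<omega>. (\<Sum>i=1..n. ?Z i \<omega>) + (\<Sum>i=n+1..N. ?Z' i \<omega>))
      ((\<Sum>i=1..n. a\<^sup>2 * B_Y\<^sup>2) + (\<Sum>i=n+1..N. a'\<^sup>2 * B_Y\<^sup>2)) c"
    by (rule sub_gamma_add[OF indep lab unlab])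
  moreover have "(\<Sum>i=1..n. ?Z i \<omega>) + (\<Sum>i=n+1..N. ?Z' i \<omega>)
      = \<sigma> * moment_gap n N f (\<lambda>i. X i \<omega>) (\<lambda>i. Y i \<omega>) $ j" for \<omega>
  proof -
    have "(\<Sum>i=1..n. ?Z i \<omega>) = a * (\<Sum>i=1..n. Y i \<omega> * X i \<omega> $ j) - real n * (a * \<mu>)"
      by (simp add: right_diff_distrib sum_subtractf sum_distrib_left)
    moreover have "real n * (a * \<mu>) = \<sigma> * \<mu>" using pos by (simp add: a_def)
    moreover have "(\<Sum>i=n+1..N. ?Z' i \<omega>)
        = a' * (\<Sum>i=n+1..N. f (X i \<omega>) * X i \<omega> $ j) - real m * (a' * \<mu>)"
      using n by (simp add: right_diff_distrib sum_subtractf sum_distrib_left m_def)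
    moreover have "real m * (a' * \<mu>) = - (\<sigma> * \<mu>)" using pos by (simp add: a'_def)
    ultimately show ?thesis
      by (simp add: moment_gap_nth a_def a'_def m_def algebra_simps)
  qed
  moreover have "(\<Sum>i=1..n. a\<^sup>2 * B_Y\<^sup>2) + (\<Sum>i=n+1..N. a'\<^sup>2 * B_Y\<^sup>2) \<le> 2 * B_Y\<^sup>2 / real k"
  proof -
    have "(\<Sum>i=1..n. a\<^sup>2 * B_Y\<^sup>2) + (\<Sum>i=n+1..N. a'\<^sup>2 * B_Y\<^sup>2)
        = real n * (a\<^sup>2 * B_Y\<^sup>2) + real m * (a'\<^sup>2 * B_Y\<^sup>2)"
      using n by (simp add: m_def)
    also have "\<dots> = B_Y\<^sup>2 / real n + B_Y\<^sup>2 / real m"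
      unfolding a2 using pos by (simp add: power2_eq_square)
    also have "\<dots> \<le> B_Y\<^sup>2 / real k + B_Y\<^sup>2 / real k"
      using pos by (intro add_mono divide_left_mono) (auto simp: k_def)
    finally show ?thesis by simp
  qed
  ultimately have "sub_gamma M (\<lambda>\<omega>. \<sigma> * moment_gap n N f (\<lambda>i. X i \<omega>) (\<lambda>i. Y i \<omega>) $ j) (2 * B_Y\<^sup>2 / real k) c"
    by (simp only:) (rule sub_gamma_mono, auto)
  then show ?thesis by (simp add: c_def k_def m_def)
qed

text \<open>The left-hand side of the assumption on \<open>r\<close> is the sub-gamma threshold \<open>sqrt (2 v L) + c L\<close> at
  \<open>L = ln (2 p / \<delta>)\<close>, for the \<open>v\<close> and \<open>c\<close> of the moment gap. The union bound runs over \<open>p\<close>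
  coordinates and two signs.\<close>

lemma moment_gap_concentration:
  fixes X :: "nat \<Rightarrow> 'a \<Rightarrow> real^'p" and P :: "((real^'p) \<times> real) measure"
  assumes "prob_space M" and "prob_space P" and sets: "sets P = sets borel"
    and n: "1 \<le> n" "n < N"
    and sample: "semisupervised_sample M P n N X Y"
    and reg: "is_regression_function P f"
    and cn: "centered_normalized P"
    and bnd: "bounded_by P B_Y B_X" and B_Y: "0 < B_Y"
    and \<delta>: "0 < \<delta>" "\<delta> < 1"
    and s: "s = sqrt (ln (2 * real CARD('p) / \<delta>) / real (min n (N - n)))"
    and r: "2 * B_Y * s * (1 + B_X / 3 * s) \<le> r"
  shows "1 - \<delta> \<le> measure M {\<omega> \<in> space M. \<forall>j. \<bar>moment_gap n N f (\<lambda>i. X i \<omega>) (\<lambda>i. Y i \<omega>) $ j\<bar> \<le> r}"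
proof -
  interpret prob_space M by fact
  define k where "k = real (min n (N - n))"
  have k: "0 < k" using n by (simp add: k_def)
  define L where "L = ln (2 * real CARD('p) / \<delta>)"
  have card: "1 \<le> real CARD('p)" by (simp add: Suc_le_eq)
  then have "\<delta> < 2 * real CARD('p)" using \<delta> by linarith
  then have "1 < 2 * real CARD('p) / \<delta>" using \<delta> by (simp add: less_divide_eq)
  then have L: "0 < L" "exp (- L) = \<delta> / (2 * real CARD('p))"
    using \<delta> by (simp_all add: L_def exp_minus)
  have s2: "s\<^sup>2 = L / k" "0 \<le> s" using k L by (simp_all add: s L_def[symmetric] k_def[symmetric])
  let ?g = "\<lambda>\<omega> j. moment_gap n N f (\<lambda>i. X i \<omega>) (\<lambda>i. Y i \<omega>) $ j"
  have f: "f \<in> borel_measurable borel" using reg by (simp add: is_regression_function_def)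
  note gm[measurable] = moment_gap_measurable[OF sample n(2) f]
  \<comment> \<open>The bad event for a coordinate and a sign.\<close>
  let ?A = "\<lambda>p. {\<omega> \<in> space M. r \<le> (if snd p then 1 else -1) * ?g \<omega> (fst p)}"
  have A: "prob (?A p) \<le> exp (- L)" for p :: "'p \<times> bool"
  proof -
    define \<sigma> :: real where "\<sigma> = (if snd p then 1 else -1)"
    define v where "v = 2 * B_Y\<^sup>2 / k"
    define c where "c = 2 * (B_Y * B_X) / (3 * k)"
    have "sub_gamma M (\<lambda>\<omega>. \<sigma> * ?g \<omega> (fst p)) v c"
      unfolding v_def c_def k_def
      by (rule moment_gap_sub_gamma[OF \<open>prob_space M\<close> \<open>prob_space P\<close> sets n sample reg cn bnd]) (simp add: \<sigma>_def)
    moreover have "0 < v" using B_Y k by (simp add: v_def)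
    moreover have "0 \<le> c" using B_Y k bounded_byD(4)[OF \<open>prob_space P\<close> bnd] by (simp add: c_def)
    ultimately have "prob {\<omega> \<in> space M. sqrt (2 * v * L) + c * L \<le> \<sigma> * ?g \<omega> (fst p)} \<le> exp (- L)"
      using L by (intro sub_gamma_tail) auto
    moreover have "sqrt (2 * v * L) + c * L \<le> r"
    proof -
      have "2 * v * L = (2 * B_Y * s)\<^sup>2" by (simp add: v_def power_mult_distrib s2)
      then have "sqrt (2 * v * L) = 2 * B_Y * s" using B_Y s2 by simp
      moreover have "c * L = 2 * B_Y * B_X / 3 * s\<^sup>2" by (simp add: c_def s2)
      ultimately have "sqrt (2 * v * L) + c * L = 2 * B_Y * s * (1 + B_X / 3 * s)"
        by (simp add: power2_eq_square algebra_simps)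
      then show ?thesis using r by simp
    qed
    then have "prob {\<omega> \<in> space M. r \<le> \<sigma> * ?g \<omega> (fst p)}
        \<le> prob {\<omega> \<in> space M. sqrt (2 * v * L) + c * L \<le> \<sigma> * ?g \<omega> (fst p)}"
      by (intro finite_measure_mono) auto
    ultimately show ?thesis by (simp add: \<sigma>_def)
  qed
  have bad: "prob (\<Union>p\<in>UNIV. ?A p) \<le> \<delta>"
  proof -
    have "prob (\<Union>p\<in>UNIV. ?A p) \<le> (\<Sum>p\<in>UNIV. prob (?A p))"
      by (intro finite_measure_subadditive_finite) auto
    also have "\<dots> \<le> (\<Sum>p\<in>(UNIV :: ('p \<times> bool) set). exp (- L))" by (intro sum_mono A)
    also have "\<dots> = \<delta>" using card by (simp add: L card_cartesian_product)
    finally show ?thesis .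
  qed
  have "space M - (\<Union>p\<in>UNIV. ?A p) \<subseteq> {\<omega> \<in> space M. \<forall>j. \<bar>?g \<omega> j\<bar> \<le> r}"
  proof clarify
    fix \<omega> j assume "\<omega> \<in> space M" "\<omega> \<notin> (\<Union>p\<in>UNIV. ?A p)"
    then have "\<omega> \<notin> ?A (j, True)" "\<omega> \<notin> ?A (j, False)" by blast+
    with \<open>\<omega> \<in> space M\<close> have "\<not> r \<le> ?g \<omega> j" "\<not> r \<le> - ?g \<omega> j" by auto
    then show "\<bar>?g \<omega> j\<bar> \<le> r" by linarith
  qed
  then have "prob (space M - (\<Union>p\<in>UNIV. ?A p)) \<le> prob {\<omega> \<in> space M. \<forall>j. \<bar>?g \<omega> j\<bar> \<le> r}"
    by (intro finite_measure_mono) auto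
  moreover have "prob (space M - (\<Union>p\<in>UNIV. ?A p)) = 1 - prob (\<Union>p\<in>UNIV. ?A p)"
    by (intro prob_compl sets.finite_UN) auto
  ultimately show ?thesis using bad by linarith
qed

section \<open>The oracle inequality\<close>

theorem theorem5:
  fixes M :: "'a measure" and P :: "((real^'p) \<times> real) measure"
    and X :: "nat \<Rightarrow> 'a \<Rightarrow> real^'p" and Y :: "nat \<Rightarrow> 'a \<Rightarrow> real"
    and f_star :: "real^'p \<Rightarrow> real" and beta_hat :: "'a \<Rightarrow> real^'p"
    and n N :: nat and B_Y B_X lam \<delta> :: real
  assumes "prob_space M" and "prob_space P" and "sets P = sets borel"
    and "1 \<le> n" and "n < N"
    and "semisupervised_sample M P n N X Y"
    and "is_regression_function P f_star"
    and "centered_normalized P"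
    and "bounded_by P B_Y B_X"
    and "0 < \<delta>" and "\<delta> < 1" and "0 < lam"
    and "lam \<ge> 4 * B_Y * sqrt (ln (2 * real CARD('p) / \<delta>) / real (min n (N - n)))
           * (1 + B_X / 3 * sqrt (ln (2 * real CARD('p) / \<delta>) / real (min n (N - n))))"
    and "\<And>\<omega>. \<omega> \<in> space M \<Longrightarrow>
           \<exists>\<beta>. is_transductive_lasso n N lam (\<lambda>i. X i \<omega>) (\<lambda>i. Y i \<omega>) \<beta> \<Longrightarrow>
           is_transductive_lasso n N lam (\<lambda>i. X i \<omega>) (\<lambda>i. Y i \<omega>) (beta_hat \<omega>)"
  shows "\<exists>E \<in> sets M. measure M E \<ge> 1 - \<delta> \<and>
    (\<forall>\<omega>\<in>E.
       ereal (transductive_risk n N f_star (\<lambda>i. X i \<omega>) (linear_predictor (beta_hat \<omega>)))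
       \<le> (INF (\<beta>, J) \<in> (UNIV :: ((real^'p) \<times> 'p set) set).
            ereal (transductive_risk n N f_star (\<lambda>i. X i \<omega>) (linear_predictor \<beta>)
                   + 4 * lam * l1_norm (restrict_vec (- J) \<beta>))
            + ereal (9 * lam\<^sup>2 * real (card J))
              / (4 * compatibility_constant (Sigma_unlab n N (\<lambda>i. X i \<omega>)) J 3)))"
proof -
  define s where "s = sqrt (ln (2 * real CARD('p) / \<delta>) / real (min n (N - n)))"
  let ?g = "\<lambda>\<omega>. moment_gap n N f_star (\<lambda>i. X i \<omega>) (\<lambda>i. Y i \<omega>)"
  define E where "E = {\<omega> \<in> space M. \<forall>j. \<bar>?g \<omega> $ j\<bar> \<le> lam / 2}"
  have lam: "2 * B_Y * s * (1 + B_X / 3 * s) \<le> lam / 2"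
    using assms(13) unfolding s_def[symmetric] by simp
  have s0: "0 \<le> s"
  proof -
    have "1 \<le> real CARD('p)" by (simp add: Suc_le_eq)
    then have "\<delta> \<le> 2 * real CARD('p)" using assms(11) by linarith
    then show ?thesis using assms(10) by (simp add: s_def le_divide_eq)
  qed
  note B0 = bounded_byD(3,4)[OF assms(2,9)]
  \<comment> \<open>The concentration bound requires a positive bound on the labels. If \<open>B_Y = 0\<close>, a small positive one will
    do, since \<open>lam\<close> is positive.\<close>
  obtain b where b: "0 < b" "B_Y \<le> b" "2 * b * s * (1 + B_X / 3 * s) \<le> lam / 2"
  proof (cases "B_Y = 0")
    case True
    define d where "d = 4 * s * (1 + B_X / 3 * s)"
    have d0: "0 \<le> d" using s0 B0 by (simp add: d_def)
    have "2 * (lam / (d + 1)) * s * (1 + B_X / 3 * s) = lam / 2 * (d / (d + 1))"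
      by (simp add: d_def)
    also have "\<dots> \<le> lam / 2" using d0 assms(12) by (intro mult_left_le) auto
    finally show ?thesis using d0 assms(12) True by (intro that[of "lam / (d + 1)"]) auto
  next
    case False
    then show ?thesis using B0 lam by (intro that[of B_Y]) auto
  qed
  have bnd: "bounded_by P b B_X" by (rule bounded_by_mono[OF assms(2,3,9) b(2)])
  have f: "f_star \<in> borel_measurable borel"
    using assms(7) by (simp add: is_regression_function_def)
  note moment_gap_measurable[OF assms(6,5) f, measurable]
  have "E \<in> sets M" unfolding E_def by measurable
  moreover have "1 - \<delta> \<le> measure M E"
    unfolding E_def by (rule moment_gap_concentration[OF assms(1-8) bnd b(1) assms(10,11) s_def b(3)])
  moreover have "ereal (transductive_risk n N f_star (\<lambda>i. X i \<omega>) (linear_predictor (beta_hat \<omega>)))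
       \<le> ereal (transductive_risk n N f_star (\<lambda>i. X i \<omega>) (linear_predictor \<beta>)
                   + 4 * lam * l1_norm (restrict_vec (- J) \<beta>))
            + ereal (9 * lam\<^sup>2 * real (card J))
              / (4 * compatibility_constant (Sigma_unlab n N (\<lambda>i. X i \<omega>)) J 3)"
    if "\<omega> \<in> E" for \<omega> \<beta> J
  proof -
    have \<omega>: "\<omega> \<in> space M" and gap: "\<And>j. \<bar>?g \<omega> $ j\<bar> \<le> lam / 2"
      using that by (auto simp: E_def)
    from assms(14)[OF \<omega> transductive_lasso_exists[OF assms(12) gap]] show ?thesis
      by (rule transductive_lasso_oracle_inequality[OF assms(12) gap])
  qed
  ultimately show ?thesis by (intro bexI[of _ E]) (auto intro!: INF_greatest)
qed

end
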